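(* Let $q$ be a complex number with $0<|q|<1$, fix a cube root $q^{1/3}$ of $q$, and for rational $a$ with $3a\in\mathbb{Z}$ set $q^{a}:=(q^{1/3})^{3a}$. Then the following four identities hold (all series converge absolutely): \begin{equation*} \begin{split} \sum_{k,l,r,s\in\mathbb{Z}} \rho_{r,s} (-1)^{k+l+r+s} \bigl(\delta(k) - \delta (r) \bigr) \bigl(\delta(l) - \delta(s)\bigr)\ q^{(k^2+l^2+r^2+3rs+s^2 +3r+3s +1)/3} &=-(q;q)_\infty \Bigl(\sum_{n\in\mathbb{Z}} (-1)^n q^{n^2} \Bigr)^2 \sum_{n\in\mathbb{Z}} (-1)^n q^{5n^2/2+ 3n/2},\\ \sum_{k,l,r,s\in\mathbb{Z}} \rho_{r,s} (-1)^{k+l+r+s} \bigl(\delta(k) - \delta (r-1) \bigr) \bigl(\delta(l) - \delta(s-1)\bigr)\ q^{(k^2+l^2+r^2+3rs+s^2 +r+s)/3} &=(q;q)_\infty \Bigl(\sum_{n\in\mathbb{Z}} (-1)^n q^{n^2} \Bigr)^2 \sum_{n\in\mathbb{Z}} (-1)^n q^{5n^2/2+ n/2},\\ \sum_{k,l,r,s\in\mathbb{Z}} \rho_{r,s} \bigl(\delta(k-1) - \delta (r) \bigr) \bigl(\delta(l-1) - \delta(s)\bigr)\ q^{(k(k+1)/2 + l(l+1)/2+2r^2+6rs +2s^2 +3r+3s)/3} &=(q^2;q^2)_\infty \Bigl(\sum_{n\in\mathbb{Z}} q^{n(n+1)/2} \Bigr)^2 \sum_{n\in\mathbb{Z}}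 (-1)^n q^{5n^2+ n},\\ \sum_{k,l,r,s\in\mathbb{Z}} \rho_{r,s} \bigl(\delta(k-1) - \delta (r+1) \bigr) \bigl(\delta(l-1) - \delta(s+1)\bigr)\ q^{(k(k+1)/2 + l(l+1)/2+2r^2+6rs +2s^2 +r+s-2)/3} &=(q^2;q^2)_\infty \Bigl(\sum_{n\in\mathbb{Z}} q^{n(n+1)/2} \Bigr)^2 \sum_{n\in\mathbb{Z}} (-1)^n q^{5n^2+ 3n}. \end{split} \end{equation*}
   Context: For $r,s\in\mathbb{Z}$: $\rho_{r,s}=1$ if $r,s\ge 0$, $\rho_{r,s}=-1$ if $r,s<0$, and $\rho_{r,s}=0$ otherwise. For $r\in\mathbb{Z}$: $\delta(r)=1$ if $r\equiv 0 \pmod 3$ and $\delta(r)=0$ otherwise. The notation $(x;q)_\infty=\prod_{n=0}^\infty(1-xq^n)$. *)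

theory Defs
  imports "HOL-Analysis.Analysis"
begin

definition rho :: "int \<Rightarrow> int \<Rightarrow> complex" where
  "rho r s = (if r \<ge> 0 \<and> s \<ge> 0 then 1 else if r < 0 \<and> s < 0 then -1 else 0)"

definition delta :: "int \<Rightarrow> complex" where
  "delta r = (if r mod 3 = 0 then 1 else 0)"

definition qpoch_inf :: "complex \<Rightarrow> complex \<Rightarrow> complex" where
  "qpoch_inf x q = (\<Prod>n::nat. 1 - x * q ^ n)"

text \<open>With \<open>w\<close> the chosen cube root of \<open>q\<close>, \<open>qpow w a\<close> is the power \<open>q\<^sup>a\<close> for rational \<open>a\<close>
  such that \<open>3 * a\<close> is an integer; the floor only converts that integer to type \<open>int\<close>, and the
  value is meaningless for other \<open>a\<close>.\<close>

definition qpow :: "complex \<Rightarrow> rat \<Rightarrow> complex" where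
  "qpow w a = w powi \<lfloor>3 * a\<rfloor>"

end

theory Submission
  imports Defs
begin

text \<open>
  Each left-hand side is \<open>\<Sum> \<rho>(r, s) Q\<^bsup>rs\<^esup> g\<^sub>r g\<^sub>s\<close> with \<open>Q = q\<close> or \<open>Q = q\<^sup>2\<close>, where \<open>g\<^sub>r\<close> is the inner sum
  over \<open>k\<close> (and \<open>g\<^sub>s\<close> that over \<open>l\<close>). Because of the factor \<open>\<delta>(k) - \<delta>(r)\<close>, the function \<open>\<Sum> g\<^sub>r x\<^sup>r\<close>
  vanishes at all integral powers of \<open>Q\<close> and hence equals \<open>\<theta>(x; Q) D(x)\<close> with a theta function
  \<open>D(x) = \<Sum> d\<^sub>m x\<^sup>m\<close> of nome \<open>Q\<^sup>2\<close>. By Kronecker's identity the factors \<open>\<theta>(x; Q) \<theta>(y; Q)\<close> cancel the poles of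
  \<open>\<Sum> \<rho>(r, s) x\<^sup>r y\<^sup>s Q\<^bsup>rs\<^esup>\<close>, and the indefinite sum becomes the constant term of
  \<open>D(x) D(y) \<theta>(1/xy; Q)\<close> times \<open>(Q; Q)\<^sup>3\<close>, i.e. a single theta series. The constant factors are
  identified through the Jacobi triple product. All kernels satisfy \<open>\<bar>\<rho>(r, s) Q\<^bsup>rs\<^esup>\<bar> \<le> 1\<close>, so every
  rearrangement is justified by absolute convergence.
\<close>

text \<open>Why the function of x vanishes at x = Q^N: completing the square in r turns the weight
  of r into that of k. In the alternating case with N odd, r moves by 3(N+1)/2, a multiple of three,
  and the sum becomes antisymmetric under exchange of the two variables; with N even, r -> -3(N+1) -
  r reverses its sign. In the triangular case j = 2r + 1 + 3N takes over the role of k; j -> -1 - j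
  exchanges the parities, so the sum over j is half of a full one and the same exchange applies.
  Kronecker's series itself converges only in an annulus. Multiplied by both theta functions and
  read off on coefficients, it involves only finite geometric sums and absolutely convergent
  families. Identities two and four use the kernels of one and three with r replaced by r - 1 and -1
  - r. As Q^(rs) stays fixed, this does not reindex the fourfold sum; it changes D, and with it the
  final theta series.\<close>

no_notation Infinite_Set_Sum.abs_summable_on (infix "abs'_summable'_on" 50)

section \<open>Absolutely summable families\<close>

lemma abs_summable_on_times:
  fixes f :: "'a \<Rightarrow> 'c::{real_normed_div_algebra, banach}" and g :: "'b \<Rightarrow> 'c"
  assumes "f abs_summable_on A" and "g abs_summable_on B"
  shows "(\<lambda>(x, y). f x * g y) abs_summable_on (A \<times> B)"
  unfolding Infinite_Sum.abs_summable_on_Sigma_iff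
  using assms by (auto simp: norm_mult infsum_cmult_right' infsum_nonneg
      intro!: summable_on_cmult_right summable_on_cmult_left)

lemma summable_on_int_weighted_geometric:
  fixes r :: real
  assumes "0 < r" "r < 1"
  shows "(\<lambda>n::int. (1 + of_int \<bar>n\<bar>) * r ^ nat \<bar>n\<bar>) summable_on UNIV"
proof -
  let ?f = "\<lambda>n::int. (1 + of_int \<bar>n\<bar>) * r ^ nat \<bar>n\<bar>"
  have "summable (\<lambda>n. of_nat (Suc n) * r ^ n)"
    using geometric_deriv_sums[of r] assms by (auto simp: sums_iff)
  then have *: "(\<lambda>n::nat. of_nat (Suc n) * r ^ n) summable_on UNIV"
    using assms by (subst summable_on_UNIV_nonneg_real_iff) auto
  have "?f summable_on range int"
    by (subst summable_on_reindex) (use * in \<open>auto simp: o_def\<close>)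
  moreover have "?f summable_on range (\<lambda>n. - int n)"
    by (subst summable_on_reindex) (use * in \<open>auto simp: o_def inj_on_def\<close>)
  ultimately have "?f summable_on (range int \<union> range (\<lambda>n. - int n))"
    by (rule summable_on_union)
  also have "range int \<union> range (\<lambda>n. - int n) = UNIV"
    by (auto intro: int_cases2)
  finally show ?thesis .
qed

text \<open>The quadratic exponent exceeds |n| up to a constant, so a geometric series dominates.
  The weight 1 + |n| serves both theta series and their derivatives, the latter for
  \<open>jacobi_cube\<close>.\<close>

lemma gaussian_summable_aux:
  fixes v :: complex and A B C :: int
  assumes "0 < norm v" "norm v < 1" "0 < A"
  shows "(\<lambda>n::int. (1 + of_int \<bar>n\<bar>) * norm v powi (A * n\<^sup>2 + B * n + C)) summable_on UNIV"
proof -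
  define r where "r = norm v"
  \<comment> \<open>With c = |B| + 1, the bound c|n| <= n^2 + c^2 leaves one spare |n| after B n is
    absorbed; the loss is c^2.\<close>
  define K where "K = C - (\<bar>B\<bar> + 1)\<^sup>2"
  have r: "0 < r" "r < 1" using assms by (auto simp: r_def)
  have le: "\<bar>n\<bar> + K \<le> A * n\<^sup>2 + B * n + C" for n :: int
  proof -
    have "0 \<le> (\<bar>n\<bar> - (\<bar>B\<bar> + 1))\<^sup>2 + \<bar>n\<bar> * (\<bar>B\<bar> + 1)" by simp
    then have "(\<bar>B\<bar> + 1) * \<bar>n\<bar> \<le> n\<^sup>2 + (\<bar>B\<bar> + 1)\<^sup>2"
      by (simp add: power2_eq_square algebra_simps)
    moreover have "n\<^sup>2 \<le> A * n\<^sup>2" using assms(3) mult_right_mono[of 1 A "n\<^sup>2"] by simp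
    moreover have "- (\<bar>B\<bar> * \<bar>n\<bar>) \<le> B * n" by (metis abs_mult abs_ge_minus_self minus_le_iff)
    ultimately show ?thesis by (simp add: K_def algebra_simps)
  qed
  have bound: "r powi (A * n\<^sup>2 + B * n + C) \<le> r ^ nat \<bar>n\<bar> * r powi K" for n :: int
  proof -
    have "r powi (A * n\<^sup>2 + B * n + C) \<le> r powi (\<bar>n\<bar> + K)"
      using power_int_decreasing[OF le, of r n] r by simp
    also have "\<dots> = r powi \<bar>n\<bar> * r powi K"
      using r by (simp add: power_int_add)
    also have "r powi \<bar>n\<bar> = r ^ nat \<bar>n\<bar>" by (simp add: power_int_def)
    finally show ?thesis .
  qed
  have "(\<lambda>n::int. (1 + of_int \<bar>n\<bar>) * r ^ nat \<bar>n\<bar> * r powi K) summable_on UNIV"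
    by (intro summable_on_cmult_left summable_on_int_weighted_geometric r)
  then show ?thesis
    unfolding r_def[symmetric]
    apply (rule summable_on_comparison_test)
    using bound r by (auto simp: mult.assoc intro!: mult_left_mono)
qed

lemma gaussian_abs_summable:
  fixes v :: complex and A B C :: int
  assumes "0 < norm v" "norm v < 1" "0 < A"
  shows "(\<lambda>n::int. v powi (A * n\<^sup>2 + B * n + C)) abs_summable_on UNIV"
    and "(\<lambda>n::int. of_int n * v powi (A * n\<^sup>2 + B * n + C)) abs_summable_on UNIV"
proof -
  have nn: "0 \<le> norm v powi k" for k using assms by auto
  show "(\<lambda>n::int. v powi (A * n\<^sup>2 + B * n + C)) abs_summable_on UNIV"
    by (rule summable_on_comparison_test[OF gaussian_summable_aux[OF assms, of B C]])
      (auto simp: norm_power_int algebra_simps nn)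
  show "(\<lambda>n::int. of_int n * v powi (A * n\<^sup>2 + B * n + C)) abs_summable_on UNIV"
    by (rule summable_on_comparison_test[OF gaussian_summable_aux[OF assms, of B C]])
      (auto simp: norm_power_int norm_mult algebra_simps nn)
qed

text \<open>Tannery's theorem, carried from \<open>nat\<close> to \<open>int\<close> by the
  enumeration \<open>int_decode\<close>; domination by \<open>M\<close> makes every series involved
  absolutely convergent, so the order of summation is immaterial.\<close>

lemma tendsto_infsum_int_dominated:
  fixes a :: "nat \<Rightarrow> int \<Rightarrow> complex"
  assumes lim: "\<And>k. (\<lambda>n. a n k) \<longlonglongrightarrow> b k"
    and bound: "\<And>n k. norm (a n k) \<le> M k" and M: "M summable_on UNIV"
  shows "(\<lambda>n. \<Sum>\<^sub>\<infinity>k. a n k) \<longlonglongrightarrow> (\<Sum>\<^sub>\<infinity>k. b k)"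
proof -
  have to_nat: "infsum f UNIV = (\<Sum>k. f (int_decode k))" if "f abs_summable_on UNIV" for f :: "int \<Rightarrow> complex"
  proof -
    have "(\<lambda>k. f (int_decode k)) summable_on UNIV"
      using abs_summable_summable[OF that] summable_on_reindex_bij_betw[OF bij_int_decode, of f] by simp
    moreover have "infsum f UNIV = (\<Sum>\<^sub>\<infinity>k. f (int_decode k))"
      using infsum_reindex_bij_betw[OF bij_int_decode, of f] by simp
    ultimately show ?thesis
      by (metis has_sum_imp_sums has_sum_infsum sums_unique)
  qed
  have boundb: "norm (b k) \<le> M k" for k
    using lim[of k] bound by (intro tendsto_upperbound[OF tendsto_norm]) auto
  have "(\<lambda>k. M (int_decode k)) summable_on UNIV"
    using M summable_on_reindex_bij_betw[OF bij_int_decode, of M] by simp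
  then have "summable (\<lambda>k. M (int_decode k))" by (rule summable_on_imp_summable)
  then have "(\<lambda>n. \<Sum>k. a n (int_decode k)) \<longlonglongrightarrow> (\<Sum>k. b (int_decode k))"
    using tannerys_theorem[of "\<lambda>k n. a n (int_decode k)" "\<lambda>k. b (int_decode k)" sequentially
        "\<lambda>k. M (int_decode k)"] lim bound by (simp add: case_prod_unfold)
  moreover have "a n abs_summable_on UNIV" for n
    by (rule Infinite_Sum.abs_summable_on_comparison_test'[OF M bound])
  moreover have "b abs_summable_on UNIV"
    by (rule Infinite_Sum.abs_summable_on_comparison_test'[OF M boundb])
  ultimately show ?thesis by (simp add: to_nat)
qed

section \<open>Infinite products\<close>

lemma qpoch_inf_convergent_prod:
  fixes q :: complex
  assumes "norm q < 1"
  shows "convergent_prod (\<lambda>n. 1 - x * q ^ n)"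
proof -
  have "summable (\<lambda>n. norm (1 - x * q ^ n - 1))"
    using assms by (simp add: norm_mult norm_power summable_mult)
  from summable_imp_abs_convergent_prod[OF this] show ?thesis
    by (rule abs_convergent_prod_imp_convergent_prod)
qed

lemma qpoch_inf_LIMSEQ:
  assumes "norm q < 1"
  shows "(\<lambda>n. \<Prod>k<n. 1 - x * q ^ k) \<longlonglongrightarrow> qpoch_inf x q"
proof -
  have "(\<lambda>n. \<Prod>k\<le>n. 1 - x * q ^ k) \<longlonglongrightarrow> qpoch_inf x q"
    using convergent_prod_LIMSEQ[OF qpoch_inf_convergent_prod[OF assms]] by (simp add: qpoch_inf_def)
  then show ?thesis
    by (simp add: LIMSEQ_lessThan_iff_atMost)
qed

lemma qpoch_inf_rec:
  assumes "norm q < 1"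
  shows "qpoch_inf x q = (1 - x) * qpoch_inf (x * q) q"
proof (rule LIMSEQ_unique)
  show "(\<lambda>n. \<Prod>k<Suc n. 1 - x * q ^ k) \<longlonglongrightarrow> qpoch_inf x q"
    by (rule LIMSEQ_Suc[OF qpoch_inf_LIMSEQ[OF assms]])
  have "(\<lambda>n. (1 - x) * (\<Prod>k<n. 1 - (x * q) * q ^ k)) \<longlonglongrightarrow> (1 - x) * qpoch_inf (x * q) q"
    by (intro tendsto_intros qpoch_inf_LIMSEQ assms)
  then show "(\<lambda>n. \<Prod>k<Suc n. 1 - x * q ^ k) \<longlonglongrightarrow> (1 - x) * qpoch_inf (x * q) q"
    unfolding prod.lessThan_Suc_shift by (simp add: mult_ac)
qed

lemma qpoch_inf_square:
  assumes "norm q < 1"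
  shows "qpoch_inf x q * qpoch_inf (- x) q = qpoch_inf (x\<^sup>2) (q\<^sup>2)"
proof (rule LIMSEQ_unique)
  have q2: "norm (q\<^sup>2) < 1" using assms by (simp add: norm_power power_less_one_iff)
  show "(\<lambda>n. \<Prod>k<n. 1 - x\<^sup>2 * (q\<^sup>2) ^ k) \<longlonglongrightarrow> qpoch_inf (x\<^sup>2) (q\<^sup>2)"
    by (rule qpoch_inf_LIMSEQ[OF q2])
  have eq: "(\<Prod>k<n. 1 - x * q ^ k) * (\<Prod>k<n. 1 - (- x) * q ^ k) = (\<Prod>k<n. 1 - x\<^sup>2 * (q\<^sup>2) ^ k)" for n
    unfolding prod.distrib[symmetric]
    by (intro prod.cong) (auto simp: algebra_simps power2_eq_square power_mult_distrib)
  show "(\<lambda>n. \<Prod>k<n. 1 - x\<^sup>2 * (q\<^sup>2) ^ k) \<longlonglongrightarrow> qpoch_inf x q * qpoch_inf (- x) q"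
    unfolding eq[symmetric] by (intro tendsto_intros qpoch_inf_LIMSEQ assms)
qed

lemma qpoch_inf_dissect:
  assumes "norm q < 1" "0 < j"
  shows "qpoch_inf x q = (\<Prod>i<j. qpoch_inf (x * q ^ i) (q ^ j))"
proof (rule LIMSEQ_unique)
  have qj: "norm (q ^ j) < 1" using assms by (simp add: norm_power power_less_one_iff)
  have "strict_mono (\<lambda>n. n * j)" using assms by (auto simp: strict_mono_def)
  from LIMSEQ_subseq_LIMSEQ[OF qpoch_inf_LIMSEQ[OF assms(1)] this]
  show "(\<lambda>n. \<Prod>k<n * j. 1 - x * q ^ k) \<longlonglongrightarrow> qpoch_inf x q" by (simp add: o_def)
  have eq: "(\<Prod>k<n * j. 1 - x * q ^ k) = (\<Prod>i<j. \<Prod>m<n. 1 - (x * q ^ i) * (q ^ j) ^ m)" for n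
  proof -
    have "(\<Prod>k<n * j. 1 - x * q ^ k) = (\<Prod>m<n. \<Prod>k = m * j..<m * j + j. 1 - x * q ^ k)"
      by (simp add: prod.nat_group)
    also have "\<dots> = (\<Prod>m<n. \<Prod>i<j. 1 - (x * q ^ i) * (q ^ j) ^ m)"
    proof (rule prod.cong[OF refl])
      fix m
      have "(\<Prod>k = m * j..<m * j + j. 1 - x * q ^ k) = (\<Prod>i = 0..<j. 1 - x * q ^ (i + m * j))"
        using prod.shift_bounds_nat_ivl[of "\<lambda>k. 1 - x * q ^ k" 0 "m * j" j] by (simp add: add.commute)
      then show "(\<Prod>k = m * j..<m * j + j. 1 - x * q ^ k) = (\<Prod>i<j. 1 - (x * q ^ i) * (q ^ j) ^ m)"
        by (simp add: power_add power_mult [symmetric] mult_ac atLeast0LessThan)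
    qed
    also have "\<dots> = (\<Prod>i<j. \<Prod>m<n. 1 - (x * q ^ i) * (q ^ j) ^ m)" by (rule prod.swap)
    finally show ?thesis .
  qed
  show "(\<lambda>n. \<Prod>k<n * j. 1 - x * q ^ k) \<longlonglongrightarrow> (\<Prod>i<j. qpoch_inf (x * q ^ i) (q ^ j))"
    unfolding eq by (intro tendsto_prod qpoch_inf_LIMSEQ qj)
qed

lemma qpoch_inf_nonzero:
  assumes "norm x < 1" "norm q < 1"
  shows "qpoch_inf x q \<noteq> 0"
  unfolding qpoch_inf_def
proof (rule prodinf_nonzero[OF qpoch_inf_convergent_prod[OF assms(2)]])
  fix n
  have "norm (x * q ^ n) \<le> norm x * 1"
    unfolding norm_mult norm_power using assms by (intro mult_left_mono power_le_one) auto
  then have "norm (x * q ^ n) < 1" using assms by simp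
  then show "1 - x * q ^ n \<noteq> 0" by auto
qed

text \<open>Splitting (q;q) by the parity of the exponent and pairing it with (-q;q) both lead to
  (q^2;q^2), which is nonzero and cancels. This is Euler's theorem on distinct and odd
  parts.\<close>

lemma qpoch_inf_euler:
  assumes "norm q < 1"
  shows "qpoch_inf (- q) q * qpoch_inf q (q\<^sup>2) = 1"
proof -
  have q2: "norm (q\<^sup>2) < 1" using assms by (simp add: norm_power power_less_one_iff)
  have "qpoch_inf q q = qpoch_inf q (q\<^sup>2) * qpoch_inf (q\<^sup>2) (q\<^sup>2)"
    using qpoch_inf_dissect[OF assms, of 2 q] by (simp add: power2_eq_square numeral_2_eq_2)
  moreover have "qpoch_inf q q * qpoch_inf (- q) q = qpoch_inf (q\<^sup>2) (q\<^sup>2)"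
    by (rule qpoch_inf_square[OF assms])
  moreover have "qpoch_inf (q\<^sup>2) (q\<^sup>2) \<noteq> 0"
    using q2 by (rule qpoch_inf_nonzero[OF _ q2])
  ultimately show ?thesis by (metis mult.assoc mult.commute mult.right_neutral mult_cancel_right)
qed

section \<open>The Jacobi triple product\<close>

text \<open>For \<open>u\<^sup>2 = q\<close> this is \<open>(-1)\<^sup>n q\<^bsup>n(n-1)/2\<^esup>\<close>; working with a square root of the nome
  keeps all exponents integral polynomials.\<close>

definition jac :: "complex \<Rightarrow> int \<Rightarrow> complex" where
  "jac u n = (-1) powi n * u powi (n * (n - 1))"

definition qfact :: "complex \<Rightarrow> nat \<Rightarrow> complex" where
  "qfact q n = (\<Prod>i<n. 1 - q ^ Suc i)"

text \<open>The value \<open>0\<close> at negative arguments makes the three-term recursion in \<open>k\<close> below valid without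
  boundary cases.\<close>

definition inv_qfact :: "complex \<Rightarrow> int \<Rightarrow> complex" where
  "inv_qfact q m = (if m < 0 then 0 else inverse (qfact q (nat m)))"

text \<open>The Gaussian binomial coefficient of 2n over n + k, centred so that k ranges
  symmetrically over -n, ..., n.\<close>

definition central_qbinomial :: "complex \<Rightarrow> nat \<Rightarrow> int \<Rightarrow> complex" where
  "central_qbinomial q n k = qfact q (2 * n) * inv_qfact q (int n + k) * inv_qfact q (int n - k)"

lemma one_minus_power_nonzero:
  fixes q :: complex
  assumes "norm q < 1" "0 < n"
  shows "1 - q ^ n \<noteq> 0"
proof
  assume "1 - q ^ n = 0"
  then have "norm (q ^ n) = 1" by simp
  moreover have "norm (q ^ n) < 1" using assms by (simp add: norm_power power_less_one_iff)
  ultimately show False by simp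
qed

lemma one_minus_powi_nonzero:
  fixes q :: complex
  assumes "q \<noteq> 0" "norm q < 1" "n \<noteq> 0"
  shows "1 - q powi n \<noteq> 0"
proof (cases "n > 0")
  case True
  then show ?thesis using one_minus_power_nonzero[OF assms(2), of "nat n"] by (simp add: power_int_def)
next
  case False
  then have "1 - q ^ nat (- n) \<noteq> 0" using assms by (intro one_minus_power_nonzero) auto
  then show ?thesis using assms False by (auto simp: power_int_def field_simps)
qed

lemma qfact_nonzero:
  assumes "norm q < 1"
  shows "qfact q n \<noteq> 0"
  using one_minus_power_nonzero[OF assms] by (auto simp: qfact_def simp del: power_Suc)

text \<open>At m = 0 the factor 1 - q^0 vanishes, in agreement with the default value at -1; hence
  the recursion holds for every integer.\<close>

lemma inv_qfact_rec:
  assumes "q \<noteq> 0" "norm q < 1"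
  shows "inv_qfact q (m - 1) = (1 - q powi m) * inv_qfact q m"
proof -
  consider "m < 0" | "m = 0" | n where "m = int (Suc n)"
    by (metis not_less_iff_gr_or_eq zero_less_imp_eq_int gr0_implies_Suc)
  then show ?thesis
  proof cases
    case 3
    have "1 - q ^ Suc n \<noteq> 0" by (rule one_minus_power_nonzero[OF assms(2)]) simp
    moreover have "q powi m = q ^ Suc n" using power_int_of_nat[of q "Suc n"] 3 by (simp del: power_Suc)
    moreover have "nat (m - 1) = n" "nat m = Suc n" "\<not> m - 1 < 0" "\<not> m < 0" using 3 by auto
    ultimately show ?thesis
      using qfact_nonzero[OF assms(2), of n]
      by (simp add: inv_qfact_def qfact_def divide_simps del: power_Suc)
  qed (auto simp: inv_qfact_def)
qed

lemma central_qbinomial_0: "central_qbinomial q 0 k = (if k = 0 then 1 else 0)"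
  by (auto simp: central_qbinomial_def inv_qfact_def qfact_def)

lemma central_qbinomial_eq_0: "\<bar>k\<bar> > int n \<Longrightarrow> central_qbinomial q n k = 0"
  by (auto simp: central_qbinomial_def inv_qfact_def)

text \<open>Passing from n to n + 1 raises the upper index by two, so two q-Pascal steps merge into
  one relation between three neighbours. After division by common factors it is a polynomial
  identity in X, Y and q.\<close>

lemma central_qbinomial_Suc:
  assumes "q \<noteq> 0" "norm q < 1"
  shows "central_qbinomial q (Suc n) k = (1 + q ^ (2 * n + 1)) * central_qbinomial q n k
    + q powi (int n + 1 - k) * central_qbinomial q n (k - 1)
    + q powi (int n + 1 + k) * central_qbinomial q n (k + 1)"
proof -
  define A B where "A = int n + 1 + k" and "B = int n + 1 - k"
  define X Y r s where "X = q powi A" and "Y = q powi B" and "r = inv_qfact q A" and "s = inv_qfact q B"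
  \<comment> \<open>This relation eliminates n: every remaining power of q is expressed by X and
    Y.\<close>
  have AB: "X * Y = q ^ (2 * n + 2)"
    using assms power_int_of_nat[of q "2 * n + 2"] by (simp add: add.commute X_def Y_def A_def B_def flip: power_int_add)
  have XY: "q ^ (2 * n + 1) = X * Y / q" using assms by (simp add: AB)
  have r1: "inv_qfact q (int n + k) = (1 - X) * r"
    using inv_qfact_rec[OF assms, of A] by (simp add: A_def X_def r_def)
  have s1: "inv_qfact q (int n - k) = (1 - Y) * s"
    using inv_qfact_rec[OF assms, of B] by (simp add: B_def Y_def s_def)
  have "q powi (A - 1) = X / q" "q powi (B - 1) = Y / q"
    using assms by (simp_all add: X_def Y_def power_int_diff)
  then have r2: "inv_qfact q (int n + k - 1) = (1 - X / q) * (1 - X) * r"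
    and s2: "inv_qfact q (int n - k - 1) = (1 - Y / q) * (1 - Y) * s"
    using inv_qfact_rec[OF assms, of "A - 1"] inv_qfact_rec[OF assms, of "B - 1"] r1 s1
    by (simp_all add: A_def B_def mult.assoc)
  have f: "qfact q (2 * Suc n) = qfact q (2 * n) * (1 - X * Y / q) * (1 - X * Y)"
    using AB XY by (simp add: qfact_def)
  have args: "int (Suc n) + k = A" "int (Suc n) - k = B" "int n + (k - 1) = int n + k - 1"
    "int n - (k - 1) = B" "int n + (k + 1) = A" "int n - (k + 1) = int n - k - 1"
    "int n + 1 - k = B" "int n + 1 + k = A"
    by (simp_all add: A_def B_def)
  show ?thesis
    unfolding central_qbinomial_def f XY args r1 s1 r2 s2
    using assms by (simp flip: X_def Y_def r_def s_def add: field_simps)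
qed

lemma jac_plus1: "u \<noteq> 0 \<Longrightarrow> jac u (k + 1) = - (u powi (2 * k) * jac u k)"
  using power_int_add[of u "2 * k" "k * (k - 1)"]
  by (simp add: jac_def power_int_add[of "-1"] algebra_simps)

text \<open>Summation by parts: the recursion in n is moved from the coefficients onto a test
  function \<open>h\<close>. The step factor of \<open>jac\<close> absorbs the powers of q depending
  on k, leaving an operator on \<open>h\<close> with constant coefficients. It is applied to x^k for
  the triple product and to k for its derivative.\<close>

lemma has_sum_central_qbinomial_Suc:
  fixes h :: "int \<Rightarrow> complex"
  assumes u: "u \<noteq> 0" "norm u < 1" and q: "q = u\<^sup>2"
    and S: "((\<lambda>k. jac u k * central_qbinomial q n k *
              ((1 + q ^ (2 * n + 1)) * h k - q ^ n * h (k + 1) - q ^ (n + 1) * h (k - 1))) has_sum S) UNIV"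
  shows "((\<lambda>k. jac u k * central_qbinomial q (Suc n) k * h k) has_sum S) UNIV"
proof -
  have q0: "q \<noteq> 0" "norm q < 1" using u by (auto simp: q norm_power power_less_one_iff)
  \<comment> \<open>Each row has finite support, so the sums may be split for arbitrary
    \<open>h\<close>.\<close>
  have fin: "\<exists>s. ((\<lambda>k. jac u k * central_qbinomial q n k * g k) has_sum s) UNIV" for g
  proof -
    have "{k. jac u k * central_qbinomial q n k * g k \<noteq> 0} \<subseteq> {- int n..int n}"
    proof
      fix k assume "k \<in> {k. jac u k * central_qbinomial q n k * g k \<noteq> 0}"
      then have "\<not> \<bar>k\<bar> > int n" using central_qbinomial_eq_0[of n k q] by auto
      then show "k \<in> {- int n..int n}" by auto
    qed
    then have "(\<lambda>k. jac u k * central_qbinomial q n k * g k) summable_on UNIV"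
      by (intro finite_nonzero_values_imp_summable_on) (auto intro: finite_subset)
    then show ?thesis by (auto simp: summable_on_def)
  qed
  obtain s1 where s1: "((\<lambda>k. jac u k * central_qbinomial q n k * ((1 + q ^ (2 * n + 1)) * h k)) has_sum s1) UNIV"
    using fin[of "\<lambda>k. (1 + q ^ (2 * n + 1)) * h k"] by blast
  obtain s2 where s2: "((\<lambda>k. jac u k * central_qbinomial q n k * (- (q ^ n * h (k + 1)))) has_sum s2) UNIV"
    using fin[of "\<lambda>k. - (q ^ n * h (k + 1))"] by blast
  obtain s3 where s3: "((\<lambda>k. jac u k * central_qbinomial q n k * (- (q ^ (n + 1) * h (k - 1)))) has_sum s3) UNIV"
    using fin[of "\<lambda>k. - (q ^ (n + 1) * h (k - 1))"] by blast
  have shift: "bij (\<lambda>k::int. k - 1)" "bij (\<lambda>k::int. k + 1)"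
    by (rule bij_betw_byWitness[of _ "\<lambda>k. k + 1"]; simp)
      (rule bij_betw_byWitness[of _ "\<lambda>k. k - 1"]; simp)
  note s2' = has_sum_reindex_bij_betw[OF shift(1), THEN iffD2, OF s2]
  note s3' = has_sum_reindex_bij_betw[OF shift(2), THEN iffD2, OF s3]
  have eq: "jac u k * central_qbinomial q (Suc n) k * h k =
      jac u k * central_qbinomial q n k * ((1 + q ^ (2 * n + 1)) * h k)
      + jac u (k - 1) * central_qbinomial q n (k - 1) * (- (q ^ n * h (k - 1 + 1)))
      + jac u (k + 1) * central_qbinomial q n (k + 1) * (- (q ^ (n + 1) * h (k + 1 - 1)))" for k
  proof -
    have j1: "jac u k = - (u powi (2 * (k - 1)) * jac u (k - 1))"
      using jac_plus1[OF u(1), of "k - 1"] by simp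
    have e1: "q powi (int n + 1 - k) * u powi (2 * (k - 1)) = q ^ n"
      and e2: "q powi (int n + 1 + k) = q ^ (n + 1) * u powi (2 * k)"
      using u(1) by (simp_all add: q power_int_add power_int_diff power_int_mult field_simps
         power2_eq_square power_int_mult_distrib)
    have "jac u k * q powi (int n + 1 - k) = - (q ^ n * jac u (k - 1))"
      unfolding j1 e1[symmetric] by (simp only: mult_minus_left mult_minus_right mult_ac)
    moreover have "jac u k * q powi (int n + 1 + k) = - (q ^ (n + 1) * jac u (k + 1))"
      unfolding jac_plus1[OF u(1)] e2 by (simp only: mult_minus_right minus_minus mult_ac)
    ultimately have a: "jac u k * q powi (int n + 1 - k) * z = - (q ^ n * jac u (k - 1)) * z"
      and b: "jac u k * q powi (int n + 1 + k) * z = - (q ^ (n + 1) * jac u (k + 1)) * z" for z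
      by simp_all
    have "jac u k * central_qbinomial q (Suc n) k * h k
      = jac u k * central_qbinomial q n k * ((1 + q ^ (2 * n + 1)) * h k)
      + jac u k * q powi (int n + 1 - k) * (central_qbinomial q n (k - 1) * h k)
      + jac u k * q powi (int n + 1 + k) * (central_qbinomial q n (k + 1) * h k)"
      unfolding central_qbinomial_Suc[OF q0] by (simp only: distrib_left distrib_right mult_ac)
    then show ?thesis unfolding a b by simp
  qed
  have "((\<lambda>k. jac u k * central_qbinomial q (Suc n) k * h k) has_sum (s1 + s2 + s3)) UNIV"
    unfolding eq by (intro has_sum_add s1 s2' s3')
  moreover have "S = s1 + s2 + s3"
  proof (rule has_sum_unique[OF S])
    have "((\<lambda>k. jac u k * central_qbinomial q n k * ((1 + q ^ (2 * n + 1)) * h k) +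
       jac u k * central_qbinomial q n k * (- (q ^ n * h (k + 1))) +
       jac u k * central_qbinomial q n k * (- (q ^ (n + 1) * h (k - 1)))) has_sum (s1 + s2 + s3)) UNIV"
      by (intro has_sum_add s1 s2 s3)
    then show "((\<lambda>k. jac u k * central_qbinomial q n k *
              ((1 + q ^ (2 * n + 1)) * h k - q ^ n * h (k + 1) - q ^ (n + 1) * h (k - 1))) has_sum (s1 + s2 + s3)) UNIV"
      by (simp add: algebra_simps)
  qed
  ultimately show ?thesis by simp
qed

text \<open>The function x^k is an eigenfunction of the operator above, with eigenvalue 1 + q^(2n+1)
  - q^n x - q^(n+1)/x = (1 - x q^n)(1 - q^(n+1)/x): exactly the two new factors.\<close>

lemma finite_jacobi_triple_product:
  assumes u: "u \<noteq> 0" "norm u < 1" and q: "q = u\<^sup>2" and x: "x \<noteq> 0"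
  shows "((\<lambda>k. jac u k * central_qbinomial q n k * x powi k) has_sum
    ((\<Prod>i<n. 1 - x * q ^ i) * (\<Prod>i<n. 1 - q / x * q ^ i))) UNIV"
proof (induction n)
  case 0
  show ?case by (rule has_sum_finite_neutralI[of "{0}"]) (auto simp: central_qbinomial_0 jac_def)
next
  case (Suc n)
  define P where "P = (\<Prod>i<n. 1 - x * q ^ i) * (\<Prod>i<n. 1 - q / x * q ^ i)"
  have "((\<lambda>k. ((1 - x * q ^ n) * (1 - q / x * q ^ n)) * (jac u k * central_qbinomial q n k * x powi k))
    has_sum ((1 - x * q ^ n) * (1 - q / x * q ^ n) * P)) UNIV"
    using Suc.IH unfolding P_def by (rule has_sum_cmult_right)
  moreover have "((1 - x * q ^ n) * (1 - q / x * q ^ n)) * (jac u k * central_qbinomial q n k * x powi k)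
    = jac u k * central_qbinomial q n k *
      ((1 + q ^ (2 * n + 1)) * x powi k - q ^ n * x powi (k + 1) - q ^ (n + 1) * x powi (k - 1))" for k
  proof -
    have "q ^ (2 * n + 1) = q * q ^ n * q ^ n" by (simp add: mult_2 power_add)
    note qq = this
    show ?thesis unfolding qq using x by (simp add: power_int_add power_int_diff field_simps)
  qed
  ultimately have "((\<lambda>k. jac u k * central_qbinomial q n k *
      ((1 + q ^ (2 * n + 1)) * x powi k - q ^ n * x powi (k + 1) - q ^ (n + 1) * x powi (k - 1)))
    has_sum ((1 - x * q ^ n) * (1 - q / x * q ^ n) * P)) UNIV"
    by (simp only:)
  from has_sum_central_qbinomial_Suc[OF u q this] show ?case
    by (simp add: P_def mult_ac)
qed

text \<open>The operator sends k to a multiple of k plus a constant. The constant contributes a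
  multiple of the finite triple product at x = 1, which is zero because of the factor 1 -
  q^0.\<close>

lemma finite_jacobi_derivative:
  assumes u: "u \<noteq> 0" "norm u < 1" and q: "q = u\<^sup>2"
  shows "((\<lambda>k. jac u k * central_qbinomial q (Suc n) k * of_int k) has_sum
    (- (qfact q n * qfact q (Suc n)))) UNIV"
proof (induction n)
  case 0
  \<comment> \<open>In row 0 the product at x = 1 is still empty, hence equal to 1, so this row is
    computed directly and the general step starts at row 1.\<close>
  have "((\<lambda>k. jac u k * central_qbinomial q 0 k *
      ((1 + q ^ (2 * 0 + 1)) * of_int k - q ^ 0 * of_int (k + 1) - q ^ (0 + 1) * of_int (k - 1)))
      has_sum (- (qfact q 0 * qfact q (Suc 0)))) UNIV"
    by (rule has_sum_finite_neutralI[of "{0}"])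
      (auto simp: central_qbinomial_0 jac_def qfact_def)
  from has_sum_central_qbinomial_Suc[OF u q this] show ?case by simp
next
  case (Suc n)
  have "((\<lambda>k. ((1 - q ^ Suc n) * (1 - q ^ Suc (Suc n))) * (jac u k * central_qbinomial q (Suc n) k * of_int k)
    + (q ^ Suc (Suc n) - q ^ Suc n) * (jac u k * central_qbinomial q (Suc n) k * 1 powi k))
    has_sum ((1 - q ^ Suc n) * (1 - q ^ Suc (Suc n)) * (- (qfact q n * qfact q (Suc n))) + (q ^ Suc (Suc n) - q ^ Suc n) *
      ((\<Prod>i<Suc n. 1 - 1 * q ^ i) * (\<Prod>i<Suc n. 1 - q / 1 * q ^ i)))) UNIV"
    by (intro has_sum_add has_sum_cmult_right Suc.IH finite_jacobi_triple_product[OF u q]) simp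
  moreover have "(\<Prod>i<Suc n. 1 - 1 * q ^ i) = 0" by (rule prod_zero) (auto intro: bexI[of _ 0])
  moreover have "((1 - q ^ Suc n) * (1 - q ^ Suc (Suc n))) * (jac u k * central_qbinomial q (Suc n) k * of_int k)
    + (q ^ Suc (Suc n) - q ^ Suc n) * (jac u k * central_qbinomial q (Suc n) k * 1 powi k)
    = jac u k * central_qbinomial q (Suc n) k *
      ((1 + q ^ (2 * Suc n + 1)) * of_int k - q ^ Suc n * of_int (k + 1) - q ^ (Suc n + 1) * of_int (k - 1))" for k
  proof -
    have "q ^ (2 * Suc n + 1) = q * q ^ Suc n * q ^ Suc n" by (simp add: mult_2 power_add)
    note qq = this
    show ?thesis unfolding qq by (simp add: algebra_simps)
  qed
  moreover have "(1 - q ^ Suc n) * (1 - q ^ Suc (Suc n)) * (- (qfact q n * qfact q (Suc n)))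
     = - (qfact q (Suc n) * qfact q (Suc (Suc n)))"
    by (simp add: qfact_def)
  ultimately have "((\<lambda>k. jac u k * central_qbinomial q (Suc n) k *
      ((1 + q ^ (2 * Suc n + 1)) * of_int k - q ^ Suc n * of_int (k + 1) - q ^ (Suc n + 1) * of_int (k - 1)))
    has_sum (- (qfact q (Suc n) * qfact q (Suc (Suc n))))) UNIV"
    by (simp only: mult_zero_left mult_zero_right add_0_right)
  from has_sum_central_qbinomial_Suc[OF u q this] show ?case by simp
qed

section \<open>Passage to the limit in the finite identities\<close>

lemma qfact_LIMSEQ:
  assumes "norm q < 1"
  shows "qfact q \<longlonglongrightarrow> qpoch_inf q q"
  using qpoch_inf_LIMSEQ[OF assms, of q] by (simp add: qfact_def[abs_def])

lemma central_qbinomial_LIMSEQ: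
  assumes "norm q < 1"
  shows "(\<lambda>n. central_qbinomial q n k) \<longlonglongrightarrow> inverse (qpoch_inf q q)"
proof -
  note lim = qfact_LIMSEQ[OF assms]
  have nz: "qpoch_inf q q \<noteq> 0" by (rule qpoch_inf_nonzero[OF assms assms])
  have inv: "(\<lambda>n. inv_qfact q (int n + k)) \<longlonglongrightarrow> inverse (qpoch_inf q q)" for k
  proof -
    have "filterlim (\<lambda>n. nat (int n + k)) sequentially sequentially"
      unfolding filterlim_at_top
    proof
      fix N
      show "eventually (\<lambda>n. N \<le> nat (int n + k)) sequentially"
        by (rule eventually_sequentiallyI[of "nat (int N - k)"]) linarith
    qed
    then have "(\<lambda>n. inverse (qfact q (nat (int n + k)))) \<longlonglongrightarrow> inverse (qpoch_inf q q)"
      by (intro tendsto_inverse nz filterlim_compose[OF lim])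
    moreover have "eventually (\<lambda>n. inverse (qfact q (nat (int n + k))) = inv_qfact q (int n + k)) sequentially"
      by (rule eventually_sequentiallyI[of "nat (- k)"]) (auto simp: inv_qfact_def)
    ultimately show ?thesis by (rule Lim_transform_eventually)
  qed
  have "(\<lambda>n. qfact q (2 * n)) \<longlonglongrightarrow> qpoch_inf q q"
    using LIMSEQ_subseq_LIMSEQ[OF lim, of "\<lambda>n. 2 * n"] by (simp add: strict_mono_def o_def)
  from tendsto_mult[OF tendsto_mult[OF this inv[of k]] inv[of "- k"]] show ?thesis
    using nz by (simp add: central_qbinomial_def[abs_def] mult.assoc)
qed

text \<open>A bound uniform in n and k together is what the dominated limit requires; it comes from
  the boundedness of the convergent sequences of q-factorials and of their inverses.\<close>

lemma central_qbinomial_bounded: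
  assumes "norm q < 1"
  obtains K where "\<And>n k. norm (central_qbinomial q n k) \<le> K"
proof -
  note lim = qfact_LIMSEQ[OF assms]
  have nz: "qpoch_inf q q \<noteq> 0" by (rule qpoch_inf_nonzero[OF assms assms])
  obtain K1 where K1: "\<And>n. norm (qfact q n) \<le> K1"
    using convergent_imp_Bseq[OF convergentI[OF lim]] by (auto simp: Bseq_def)
  obtain K2 where K2: "\<And>n. norm (inverse (qfact q n)) \<le> K2"
    using convergent_imp_Bseq[OF convergentI[OF tendsto_inverse[OF lim nz]]] by (auto simp: Bseq_def)
  have "0 \<le> K1" "0 \<le> K2" using K1[of 0] K2[of 0] norm_ge_zero order_trans by blast+
  then have "norm (inv_qfact q m) \<le> K2" for m using K2 by (auto simp: inv_qfact_def)
  then have "norm (central_qbinomial q n k) \<le> K1 * K2 * K2" for n k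
    unfolding central_qbinomial_def norm_mult using K1 \<open>0 \<le> K1\<close> \<open>0 \<le> K2\<close>
    by (intro mult_mono) auto
  then show ?thesis by (rule that)
qed

text \<open>The common limit step for the triple product and its derivative. Each weight tends to
  1/(q;q), which becomes the extra factor (q;q) on the right.\<close>

lemma jac_sum_LIMSEQ:
  assumes u: "u \<noteq> 0" "norm u < 1" and q: "q = u\<^sup>2"
    and h: "(\<lambda>k. jac u k * h k) abs_summable_on UNIV"
    and T: "\<And>n. ((\<lambda>k. jac u k * central_qbinomial q (Suc n) k * h k) has_sum T n) UNIV"
    and lim: "T \<longlonglongrightarrow> L"
  shows "((\<lambda>k. jac u k * h k) has_sum (L * qpoch_inf q q)) UNIV"
proof -
  have q1: "norm q < 1" using u by (auto simp: q norm_power power_less_one_iff)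
  have nz: "qpoch_inf q q \<noteq> 0" by (rule qpoch_inf_nonzero[OF q1 q1])
  obtain K where K: "\<And>n k. norm (central_qbinomial q n k) \<le> K"
    using central_qbinomial_bounded[OF q1] by blast
  have "(\<lambda>n. \<Sum>\<^sub>\<infinity>k. jac u k * central_qbinomial q (Suc n) k * h k)
      \<longlonglongrightarrow> (\<Sum>\<^sub>\<infinity>k. jac u k * inverse (qpoch_inf q q) * h k)"
  proof (rule tendsto_infsum_int_dominated)
    show "(\<lambda>n. jac u k * central_qbinomial q (Suc n) k * h k)
        \<longlonglongrightarrow> jac u k * inverse (qpoch_inf q q) * h k" for k
      by (intro tendsto_intros LIMSEQ_Suc central_qbinomial_LIMSEQ[OF q1])
    show "norm (jac u k * central_qbinomial q (Suc n) k * h k) \<le> K * norm (jac u k * h k)" for n k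
      using mult_right_mono[OF K[of "Suc n" k], of "norm (jac u k * h k)"] by (simp add: norm_mult mult_ac)
    show "(\<lambda>k. K * norm (jac u k * h k)) summable_on UNIV"
      by (rule summable_on_cmult_right[OF h])
  qed
  also have "(\<lambda>n. \<Sum>\<^sub>\<infinity>k. jac u k * central_qbinomial q (Suc n) k * h k) = T"
    using T by (auto intro: infsumI)
  also have "(\<Sum>\<^sub>\<infinity>k. jac u k * inverse (qpoch_inf q q) * h k) = inverse (qpoch_inf q q) * (\<Sum>\<^sub>\<infinity>k. jac u k * h k)"
    by (simp add: mult_ac flip: infsum_cmult_right')
  finally have "L = inverse (qpoch_inf q q) * (\<Sum>\<^sub>\<infinity>k. jac u k * h k)"
    using lim LIMSEQ_unique by blast
  then have "(\<Sum>\<^sub>\<infinity>k. jac u k * h k) = L * qpoch_inf q q" using nz by simp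
  then show ?thesis using abs_summable_summable[OF h] by (simp add: has_sum_iff)
qed

lemma jac_powi_abs_summable:
  assumes u: "u \<noteq> 0" "norm u < 1" and x: "x \<noteq> 0"
  shows "(\<lambda>k. jac u k * x powi k) abs_summable_on UNIV"
proof -
  have "0 < min (norm x) (inverse (norm x))" using x by simp
  \<comment> \<open>With this N, |x^k| is at most the sum of |u|^(-Nk) and |u|^(Nk), so x changes
    only the linear term of a Gaussian exponent.\<close>
  then obtain N where N: "norm u ^ N < min (norm x) (inverse (norm x))"
    using real_arch_pow_inv[of "min (norm x) (inverse (norm x))" "norm u"] u by blast
  have u0: "0 < norm u ^ N" using u by simp
  have "norm u ^ N \<le> inverse (norm x)" using N by simp
  from le_imp_inverse_le[OF this u0] have N1: "norm x \<le> inverse (norm u ^ N)" using x by simp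
  have "norm u ^ N \<le> norm x" using N by simp
  from le_imp_inverse_le[OF this u0] have N2: "inverse (norm x) \<le> inverse (norm u ^ N)" .
  have bound: "norm (x powi k) \<le> norm u powi (- int N * k) + norm u powi (int N * k)" for k
  proof (cases k)
    case (nonneg m)
    have "norm (x powi k) \<le> inverse (norm u ^ N) ^ m"
      using nonneg N1 by (simp add: norm_power power_mono)
    also have "\<dots> = norm u powi (- int N * k)"
      unfolding nonneg using power_int_of_nat[of "norm u" "N * m"]
      by (simp only: mult_minus_left power_int_minus power_inverse power_mult of_nat_mult)
    finally show ?thesis by (simp add: add_increasing2)
  next
    case (neg m)
    have "norm (x powi k) \<le> inverse (norm u ^ N) ^ Suc m"
      unfolding neg using power_mono[OF N2, of "Suc m"]
      by (simp add: norm_power_int power_int_minus power_inverse norm_power norm_inverse norm_mult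
          del: of_nat_Suc)
    also have "\<dots> = norm u powi (int N * k)"
      unfolding neg using power_int_of_nat[of "norm u" "N * Suc m"]
      by (simp only: mult_minus_right power_int_minus power_inverse power_mult of_nat_mult)
    finally show ?thesis by (simp add: add_increasing)
  qed
  have g: "(\<lambda>k. norm (u powi (1 * k\<^sup>2 + (- 1 - int N) * k + 0)) + norm (u powi (1 * k\<^sup>2 + (- 1 + int N) * k + 0))) summable_on UNIV"
    by (intro summable_on_add gaussian_abs_summable) (use u in auto)
  show ?thesis
  proof (rule summable_on_comparison_test[OF g])
    fix k :: int
    have "norm (jac u k * x powi k) = norm u powi (k * (k - 1)) * norm (x powi k)"
      by (simp add: jac_def norm_mult norm_power_int)
    also have "\<dots> \<le> norm u powi (k * (k - 1)) * (norm u powi (- int N * k) + norm u powi (int N * k))"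
      using bound by (intro mult_left_mono) auto
    also have "\<dots> = norm u powi (k * (k - 1) + - int N * k) + norm u powi (k * (k - 1) + int N * k)"
      using u by (simp only: power_int_add distrib_left norm_eq_zero simp_thms)
    finally show "norm (jac u k * x powi k)
      \<le> norm (u powi (1 * k\<^sup>2 + (- 1 - int N) * k + 0)) + norm (u powi (1 * k\<^sup>2 + (- 1 + int N) * k + 0))"
      by (simp add: norm_power_int power2_eq_square algebra_simps)
  qed simp
qed

theorem jacobi_triple_product:
  assumes u: "u \<noteq> 0" "norm u < 1" and q: "q = u\<^sup>2" and x: "x \<noteq> 0"
  shows "((\<lambda>k. jac u k * x powi k) has_sum (qpoch_inf x q * qpoch_inf (q / x) q * qpoch_inf q q)) UNIV"
proof (rule jac_sum_LIMSEQ[OF u q jac_powi_abs_summable[OF u x] finite_jacobi_triple_product[OF u q x]])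
  have "norm q < 1" using u by (auto simp: q norm_power power_less_one_iff)
  then show "(\<lambda>n. (\<Prod>i<Suc n. 1 - x * q ^ i) * (\<Prod>i<Suc n. 1 - q / x * q ^ i))
      \<longlonglongrightarrow> qpoch_inf x q * qpoch_inf (q / x) q"
    by (intro tendsto_mult LIMSEQ_Suc[OF qpoch_inf_LIMSEQ])
qed

text \<open>The derivative of the triple product at its simple zero x = 1, where 1 - x is the only
  factor to differentiate. The limit of the finite identity replaces termwise differentiation. This
  is the source of the cube in Kronecker's identity.\<close>

theorem jacobi_cube:
  assumes u: "u \<noteq> 0" "norm u < 1" and q: "q = u\<^sup>2"
  shows "((\<lambda>k. jac u k * of_int k) has_sum (- (qpoch_inf q q ^ 3))) UNIV"
proof -
  have q1: "norm q < 1" using u by (auto simp: q norm_power power_less_one_iff)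
  have "norm (jac u k * of_int k) = norm (of_int k * u powi (1 * k\<^sup>2 + (- 1) * k + 0))" for k
    by (simp add: jac_def norm_mult norm_power_int power2_eq_square algebra_simps)
  then have h: "(\<lambda>k. jac u k * of_int k) abs_summable_on UNIV"
    using gaussian_abs_summable(2)[of u 1 "- 1" 0] u by simp
  have "((\<lambda>k. jac u k * of_int k) has_sum (- (qpoch_inf q q * qpoch_inf q q) * qpoch_inf q q)) UNIV"
    by (rule jac_sum_LIMSEQ[OF u q h finite_jacobi_derivative[OF u q]])
      (intro tendsto_intros qfact_LIMSEQ[OF q1] LIMSEQ_Suc[OF qfact_LIMSEQ[OF q1]])
  then show ?thesis by (simp add: power3_eq_cube)
qed

section \<open>Hecke-type double sums\<close>

lemma has_sum_times:
  fixes f :: "'a \<Rightarrow> complex" and g :: "'b \<Rightarrow> complex"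
  assumes "f abs_summable_on A" and "g abs_summable_on B"
  shows "((\<lambda>(x, y). f x * g y) has_sum (infsum f A * infsum g B)) (A \<times> B)"
proof (rule has_sum_SigmaI)
  show "((\<lambda>y. case (x, y) of (x, y) \<Rightarrow> f x * g y) has_sum f x * infsum g B) B" for x
    using assms by (auto intro!: has_sum_cmult_right has_sum_infsum abs_summable_summable)
  show "((\<lambda>x. f x * infsum g B) has_sum infsum f A * infsum g B) A"
    using assms by (auto intro!: has_sum_cmult_left has_sum_infsum abs_summable_summable)
  show "(\<lambda>(x, y). f x * g y) summable_on A \<times> B"
    by (rule abs_summable_summable[OF abs_summable_on_times[OF assms]])
qed

text \<open>One absolutely convergent fourfold family is summed in both orders. It is applied to the
  summands of the statement, with original indices k and l, and to the theta expansion, where k and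
  l index the cofactor coefficients.\<close>

lemma quadruple_sum:
  fixes F :: "int \<Rightarrow> int \<Rightarrow> complex"
  assumes F: "(\<lambda>(k, r). F k r) abs_summable_on UNIV" and B: "\<And>r s. norm (B r s :: complex) \<le> 1"
  defines "f \<equiv> \<lambda>(k, l, r, s). B r s * F k r * F l s"
  shows "f abs_summable_on UNIV"
    and "((\<lambda>(r, s). B r s * (\<Sum>\<^sub>\<infinity>k. F k r) * (\<Sum>\<^sub>\<infinity>l. F l s)) has_sum infsum f UNIV) UNIV"
    and "((\<lambda>(k, l). \<Sum>\<^sub>\<infinity>(r, s). B r s * F k r * F l s) has_sum infsum f UNIV) UNIV"
proof -
  have "(\<lambda>((k, r), (l, s)). F k r * F l s) abs_summable_on UNIV"
    using abs_summable_on_times[OF F F] by (simp add: case_prod_unfold)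
  then have FF: "(\<lambda>p. norm (F (fst (fst p)) (snd (fst p)) * F (fst (snd p)) (snd (snd p)))) summable_on UNIV"
    by (simp add: case_prod_unfold)
  have bij1: "bij (\<lambda>(k, l, r, s). ((k, r), (l, s)))"
    by (rule bij_betw_byWitness[of _ "\<lambda>((k, r), (l, s)). (k, l, r, s)"]) auto
  have "(\<lambda>(k, l, r, s). norm (F k r * F l s)) summable_on UNIV"
    using summable_on_reindex_bij_betw[OF bij1, THEN iffD2, OF FF] by (simp add: case_prod_unfold)
  then show f: "f abs_summable_on UNIV"
  proof (rule summable_on_comparison_test)
    fix p :: "int \<times> int \<times> int \<times> int"
    obtain k l r s where p: "p = (k, l, r, s)" by (cases p) auto
    have "norm (B r s) * norm (F k r * F l s) \<le> 1 * norm (F k r * F l s)"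
      by (intro mult_right_mono B) simp
    then show "norm (f p) \<le> (case p of (k, l, r, s) \<Rightarrow> norm (F k r * F l s))"
      by (simp add: p f_def norm_mult mult.assoc)
  qed simp
  have fs: "(f has_sum infsum f UNIV) UNIV"
    by (rule has_sum_infsum[OF abs_summable_summable[OF f]])
  have Fk: "(\<lambda>k. F k r) abs_summable_on UNIV" for r
  proof -
    have "(\<lambda>x. norm ((\<lambda>(k, r). F k r) x)) summable_on range (\<lambda>k. (k, r))"
      by (rule summable_on_subset[OF F]) auto
    then show ?thesis
      by (subst (asm) summable_on_reindex) (auto simp: inj_on_def o_def)
  qed
  have bij2: "bij (\<lambda>((r, s), (k, l)). (k, l, r, s))"
    by (rule bij_betw_byWitness[of _ "\<lambda>(k, l, r, s). ((r, s), (k, l))"]) auto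
  have bij3: "bij (\<lambda>((k, l), (r, s)). (k, l, r, s))"
    by (rule bij_betw_byWitness[of _ "\<lambda>(k, l, r, s). ((k, l), (r, s))"]) auto
  show "((\<lambda>(r, s). B r s * (\<Sum>\<^sub>\<infinity>k. F k r) * (\<Sum>\<^sub>\<infinity>l. F l s)) has_sum infsum f UNIV) UNIV"
  proof (rule has_sum_SigmaD)
    show "((\<lambda>x. f (case x of ((r, s), k, l) \<Rightarrow> (k, l, r, s))) has_sum infsum f UNIV) (UNIV \<times> UNIV)"
      using has_sum_reindex_bij_betw[OF bij2, THEN iffD2, OF fs] by (simp add: case_prod_unfold)
    show "((\<lambda>y. f (case (x, y) of ((r, s), k, l) \<Rightarrow> (k, l, r, s))) has_sum
       (case x of (r, s) \<Rightarrow> B r s * (\<Sum>\<^sub>\<infinity>k. F k r) * (\<Sum>\<^sub>\<infinity>l. F l s))) UNIV" for x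
    proof -
      obtain r s where x: "x = (r, s)" by fastforce
      show ?thesis
        using has_sum_cmult_right[OF has_sum_times[OF Fk[of r] Fk[of s]], of "B r s"]
        by (simp add: x f_def case_prod_unfold mult.assoc)
    qed
  qed
  show "((\<lambda>(k, l). \<Sum>\<^sub>\<infinity>(r, s). B r s * F k r * F l s) has_sum infsum f UNIV) UNIV"
  proof (rule has_sum_SigmaD)
    show *: "((\<lambda>x. f (case x of ((k, l), r, s) \<Rightarrow> (k, l, r, s))) has_sum infsum f UNIV) (UNIV \<times> UNIV)"
      using has_sum_reindex_bij_betw[OF bij3, THEN iffD2, OF fs] by (simp add: case_prod_unfold)
    show "((\<lambda>y. f (case (x, y) of ((k, l), r, s) \<Rightarrow> (k, l, r, s))) has_sum
       (case x of (k, l) \<Rightarrow> \<Sum>\<^sub>\<infinity>(r, s). B r s * F k r * F l s)) UNIV" for x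
    proof -
      obtain k l where x: "x = (k, l)" by fastforce
      have "(\<lambda>(x, y). f (case (x, y) of ((k, l), r, s) \<Rightarrow> (k, l, r, s))) summable_on (UNIV \<times> UNIV)"
        using * by (auto simp: summable_on_def case_prod_unfold)
      from summable_on_SigmaD1[OF this, of x]
      have "(\<lambda>(r, s). B r s * F k r * F l s) summable_on UNIV"
        by (simp add: x f_def case_prod_unfold)
      then show ?thesis
        by (simp add: x f_def case_prod_unfold)
    qed
  qed
qed

section \<open>Kronecker's identity on coefficients\<close>

lemma minus_one_powi: "(-1) powi n = (if even n then 1 else - 1 :: complex)"
proof (cases "even n")
  case True
  then obtain m where "n = 2 * m" by (auto elim: evenE)
  then show ?thesis by (simp add: power_int_mult)
next
  case False
  then obtain m where "n = 2 * m + 1" by (auto elim: oddE)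
  then show ?thesis by (simp add: power_int_mult power_int_add)
qed

text \<open>On the support of \<open>rho\<close> the indices have equal sign, so r s >= 0.\<close>

lemma norm_rho_powi_le_1:
  assumes "q \<noteq> 0" "norm q < 1"
  shows "norm (rho r s * q powi (r * s)) \<le> 1"
proof (cases "rho r s = 0")
  case False
  then have "0 \<le> r * s" by (auto simp: rho_def zero_le_mult_iff split: if_splits)
  then have "norm q powi (r * s) \<le> 1"
    using assms by (simp add: power_int_def power_le_one)
  moreover have "norm (rho r s) \<le> 1" by (simp add: rho_def)
  ultimately show ?thesis by (simp add: norm_mult norm_power_int mult_le_one)
qed simp

text \<open>The reflection n -> 1 - 2N - n keeps the exponent and flips the parity, so the sum
  equals its own negative. These are the zeros of theta at the powers of its nome.\<close>

lemma jac_sum_eq_0: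
  assumes u: "u \<noteq> 0" "norm u < 1"
  shows "((\<lambda>n. jac u n * u powi (2 * N * n)) has_sum 0) UNIV"
proof -
  let ?f = "\<lambda>n. jac u n * u powi (2 * N * n)"
  have "(\<lambda>n. jac u n * (u powi (2 * N)) powi n) abs_summable_on UNIV"
    by (rule jac_powi_abs_summable) (use u in auto)
  then have "?f summable_on UNIV"
    by (auto simp: power_int_mult intro: abs_summable_summable)
  then obtain s where s: "(?f has_sum s) UNIV" by (auto simp: summable_on_def)
  have bij: "bij (\<lambda>n::int. 1 - 2 * N - n)"
    by (rule bij_betw_byWitness[of _ "\<lambda>n. 1 - 2 * N - n"]) auto
  have reflect: "?f (1 - 2 * N - n) = - ?f n" for n
  proof -
    let ?n = "1 - 2 * N - n"
    have "?n * (?n - 1) + 2 * N * ?n = n * (n - 1) + 2 * N * n" by (simp add: algebra_simps)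
    then have "u powi (?n * (?n - 1)) * u powi (2 * N * ?n) = u powi (n * (n - 1)) * u powi (2 * N * n)"
      using u by (simp flip: power_int_add)
    then show ?thesis by (simp add: jac_def minus_one_powi)
  qed
  have "((\<lambda>n. - ?f n) has_sum s) UNIV"
    using has_sum_reindex_bij_betw[OF bij, THEN iffD2, OF s] by (simp only: reflect)
  moreover have "((\<lambda>n. - ?f n) has_sum - s) UNIV" using s by (rule has_sum_uminusI)
  ultimately have "s = - s" by (rule has_sum_unique)
  then show ?thesis using s by simp
qed

text \<open>The support on r + s = n is 0..n with sign +1, or n+1..-1 with sign -1, or empty for n =
  -1. The signs of \<open>rho\<close> are just those for which one geometric formula covers all
  three cases.\<close>

lemma has_sum_rho_diagonal:
  assumes z: "z \<noteq> 0"
  shows "((\<lambda>r. rho r (n - r) * z powi r) has_sum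
    (if z = 1 then of_int (n + 1) else (z powi (n + 1) - 1) / (z - 1))) UNIV"
proof (cases "n \<ge> 0")
  case True
  then obtain N where n: "n = int N" by (auto elim: nonneg_int_cases)
  have "(\<Sum>r\<in>{0..int N}. z powi r) = (if z = 1 then of_int (n + 1) else (z powi (n + 1) - 1) / (z - 1))"
    unfolding n
  proof (induction N)
    case (Suc N)
    have "{0..int (Suc N)} = insert (int N + 1) {0..int N}" by auto
    then show ?case
      using Suc z by (auto simp: power_int_add field_simps power2_eq_square)
  qed auto
  then show ?thesis
    by (intro has_sum_finite_neutralI[of "{0..int N}"]) (auto simp: n rho_def)
next
  case False
  define N where "N = nat (- 1 - n)"
  have n: "n = - 1 - int N" using False by (simp add: N_def)
  have "(\<Sum>r\<in>{- int N..-1}. - (z powi r)) = (if z = 1 then of_int (n + 1) else (z powi (n + 1) - 1) / (z - 1))"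
    unfolding n
  proof (induction N)
    case (Suc N)
    have "{- int (Suc N)..-1} = insert (- int N - 1) {- int N..-1}" by auto
    then show ?case
      using Suc z by (auto simp: power_int_add power_int_diff power_int_minus field_simps power2_eq_square)
  qed auto
  then show ?thesis
    by (intro has_sum_finite_neutralI[of "{- int N..-1}"]) (auto simp: n rho_def)
qed

lemma jac_abs_summable:
  assumes "u \<noteq> 0" "norm u < 1"
  shows "jac u abs_summable_on UNIV"
  using jac_powi_abs_summable[OF assms, of 1] by simp

text \<open>Coefficientwise form of Kronecker's identity
  \<open>\<Sum> \<rho>(r, s) x\<^sup>r y\<^sup>s q\<^bsup>rs\<^esup> = (q; q)\<^sup>3 \<theta>(xy) / (\<theta>(x) \<theta>(y))\<close>, multiplied out by \<open>\<theta>(x) \<theta>(y)\<close>. On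
  each line \<open>r + s = n\<close> the summand depends on \<open>r\<close> only through a geometric progression.\<close>

theorem kronecker_coefficients:
  assumes u: "u \<noteq> 0" "norm u < 1" and q: "q = u\<^sup>2"
  shows "((\<lambda>(r, s). rho r s * q powi (r * s) * jac u (r - a) * jac u (s - b)) has_sum
    (if a = b then - (qpoch_inf q q ^ 3) * jac u (- a) else 0)) UNIV"
proof -
  define G where "G = (\<lambda>(r, s). rho r s * q powi (r * s) * jac u (r - a) * jac u (s - b))"
  define K where "K = (-1) powi (a + b) * u powi (a\<^sup>2 + a + b\<^sup>2 + b)"
  define z where "z = q powi (b - a)"
  have q0: "q \<noteq> 0" "norm q < 1" using u by (auto simp: q norm_power power_less_one_iff)
  have z0: "z \<noteq> 0" using q0 by (simp add: z_def)
  have qu: "q powi k = u powi (2 * k)" for k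
    using power_int_mult[of u 2 k] by (simp add: q)
  have zu: "z powi k = u powi (2 * ((b - a) * k))" for k
    unfolding z_def power_int_mult[symmetric] qu by (simp only: mult.assoc)
  note add = power_int_add[OF disjI1[OF u(1)], symmetric]
  have shift: "(\<lambda>r. jac u (r - c)) abs_summable_on UNIV" for c
  proof -
    have "bij (\<lambda>r::int. r - c)" by (rule bij_betw_byWitness[of _ "\<lambda>r. r + c"]) auto
    from summable_on_reindex_bij_betw[OF this, THEN iffD2, OF jac_abs_summable[OF u]] show ?thesis by simp
  qed
  have "G abs_summable_on UNIV"
  proof (rule summable_on_comparison_test)
    show "(\<lambda>p. norm (case p of (r, s) \<Rightarrow> jac u (r - a) * jac u (s - b))) summable_on UNIV"
      using abs_summable_on_times[OF shift[of a] shift[of b]] by simp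
    fix p :: "int \<times> int"
    obtain r s where p: "p = (r, s)" by fastforce
    have "norm (rho r s * q powi (r * s)) * norm (jac u (r - a) * jac u (s - b))
       \<le> 1 * norm (jac u (r - a) * jac u (s - b))"
      by (intro mult_right_mono norm_rho_powi_le_1 q0) simp
    then show "norm (G p) \<le> norm (case p of (r, s) \<Rightarrow> jac u (r - a) * jac u (s - b))"
      by (simp add: p G_def norm_mult mult_ac)
  qed simp
  then have G: "(G has_sum infsum G UNIV) UNIV" by (rule has_sum_infsum[OF abs_summable_summable])
  have bij: "bij (\<lambda>(n, r). (r, n - r :: int))"
    by (rule bij_betw_byWitness[of _ "\<lambda>(r, s). (r + s, r)"]) auto
  define H where "H = (\<lambda>n. if z = 1 then of_int (n + 1) else (z powi (n + 1) - 1) / (z - 1))"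
  have diag: "G (r, n - r) = K * (jac u n * u powi (2 * (- b) * n)) * (rho r (n - r) * z powi r)" for r n
  proof -
    \<comment> \<open>Since 2r(n-r) + r^2 + (n-r)^2 = n^2, only a linear term in r survives.\<close>
    have "2 * (r * (n - r)) + (r - a) * (r - a - 1) + (n - r - b) * (n - r - b - 1)
       = (a\<^sup>2 + a + b\<^sup>2 + b) + n * (n - 1) + 2 * (- b) * n + 2 * ((b - a) * r)"
      by (simp add: algebra_simps power2_eq_square)
    then have "q powi (r * (n - r)) * u powi ((r - a) * (r - a - 1)) * u powi ((n - r - b) * (n - r - b - 1))
      = u powi (a\<^sup>2 + a + b\<^sup>2 + b) * u powi (n * (n - 1)) * u powi (2 * (- b) * n) * z powi r"
      unfolding qu zu add by (simp only:)
    moreover have "(-1) powi (r - a) * (-1) powi (n - r - b) = (-1 :: complex) powi (a + b) * (-1) powi n"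
      by (auto simp: minus_one_powi)
    ultimately show ?thesis
      unfolding G_def jac_def K_def prod.case by algebra
  qed
  have "((\<lambda>n. K * (jac u n * u powi (2 * (- b) * n)) * H n) has_sum infsum G UNIV) UNIV"
  proof (rule has_sum_SigmaD)
    show "((\<lambda>(n, r). G (r, n - r)) has_sum infsum G UNIV) (UNIV \<times> UNIV)"
      using has_sum_reindex_bij_betw[OF bij, THEN iffD2, OF G] by (simp add: case_prod_unfold)
    show "((\<lambda>r. case (n, r) of (n, r) \<Rightarrow> G (r, n - r)) has_sum
      K * (jac u n * u powi (2 * (- b) * n)) * H n) UNIV" for n
      unfolding diag prod.case H_def by (intro has_sum_cmult_right has_sum_rho_diagonal z0)
  qed
  moreover have "((\<lambda>n. K * (jac u n * u powi (2 * (- b) * n)) * H n) has_sum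
    (if a = b then - (qpoch_inf q q ^ 3) * jac u (- a) else 0)) UNIV"
  proof (cases "a = b")
    case True
    \<comment> \<open>Here z = 1 and the geometric sum is n + 1. Recentring at b yields the
      derivative value from \<open>jacobi_cube\<close> plus a multiple of theta at 1, which is
      zero.\<close>
    have shift: "K * (jac u n * u powi (2 * (- b) * n)) = jac u (- b) * jac u (n - b)" for n
    proof -
      have "(a\<^sup>2 + a + b\<^sup>2 + b) + n * (n - 1) + 2 * (- b) * n = (- b) * (- b - 1) + (n - b) * (n - b - 1)"
        using True by (simp add: algebra_simps power2_eq_square)
      then have "u powi (a\<^sup>2 + a + b\<^sup>2 + b) * u powi (n * (n - 1)) * u powi (2 * (- b) * n)
        = u powi ((- b) * (- b - 1)) * u powi ((n - b) * (n - b - 1))"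
        unfolding add by (simp only:)
      then show ?thesis
        using True by (simp add: K_def jac_def minus_one_powi mult.assoc)
    qed
    have "((\<lambda>n. jac u (- b) * (jac u n * of_int n + of_int (b + 1) * (jac u n * u powi (2 * 0 * n)))) has_sum
       (jac u (- b) * (- (qpoch_inf q q ^ 3) + of_int (b + 1) * 0))) UNIV"
      by (intro has_sum_cmult_right has_sum_add jacobi_cube u q jac_sum_eq_0)
    then have *: "((\<lambda>n. jac u (- b) * (jac u n * of_int (n + b + 1))) has_sum
       (- (qpoch_inf q q ^ 3) * jac u (- b))) UNIV"
      by (simp add: algebra_simps)
    have "bij (\<lambda>n::int. n - b)" by (rule bij_betw_byWitness[of _ "\<lambda>n. n + b"]) auto
    from has_sum_reindex_bij_betw[OF this, THEN iffD2, OF *] show ?thesis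
      unfolding shift using True by (simp add: H_def z_def mult.assoc)
  next
    case False
    \<comment> \<open>Off the diagonal, both terms of the geometric formula are theta values at
      powers of the nome and vanish.\<close>
    have "z \<noteq> 1"
      using one_minus_powi_nonzero[OF q0, of "b - a"] False by (auto simp: z_def)
    have "((\<lambda>n. K / (z - 1) * (z * (jac u n * u powi (2 * (- a) * n)) + - (jac u n * u powi (2 * (- b) * n)))) has_sum
      (K / (z - 1) * (z * 0 + - 0))) UNIV"
      by (intro has_sum_cmult_right has_sum_uminusI has_sum_add jac_sum_eq_0 u)
    moreover have "K / (z - 1) * (z * (jac u n * u powi (2 * (- a) * n)) + - (jac u n * u powi (2 * (- b) * n)))
      = K * (jac u n * u powi (2 * (- b) * n)) * H n" for n
    proof -
      have "2 * (- a) * n = 2 * (- b) * n + 2 * ((b - a) * n)" by (simp add: algebra_simps)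
      then have e: "u powi (2 * (- a) * n) = u powi (2 * (- b) * n) * z powi n"
        unfolding zu add by (simp only:)
      show ?thesis
        unfolding e H_def using \<open>z \<noteq> 1\<close> z0 by (simp add: power_int_add field_simps)
    qed
    ultimately show ?thesis using False by simp
  qed
  ultimately have "infsum G UNIV = (if a = b then - (qpoch_inf q q ^ 3) * jac u (- a) else 0)"
    by (rule has_sum_unique)
  then show ?thesis using G by (simp add: G_def)
qed

text \<open>The hypothesis on \<open>g\<close> is the factorization of its generating function into
  theta times D, with coefficients \<open>d\<close> of D. By \<open>kronecker_coefficients\<close>
  the bilinear form is diagonal on shifted theta coefficients, so only the squares of
  \<open>d\<close> remain.\<close>

theorem hecke_sum_convolution:
  assumes u: "u \<noteq> 0" "norm u < 1" and q: "q = u\<^sup>2"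
    and d: "d abs_summable_on UNIV"
    and g: "\<And>r. ((\<lambda>m. d m * jac u (r - m)) has_sum g r) UNIV"
  shows "((\<lambda>(r, s). rho r s * q powi (r * s) * g r * g s) has_sum
    (- (qpoch_inf q q ^ 3) * (\<Sum>\<^sub>\<infinity>m. (d m)\<^sup>2 * jac u (- m)))) UNIV"
proof -
  define F where "F = (\<lambda>m r. d m * jac u (r - m))"
  have q0: "q \<noteq> 0" "norm q < 1" using u by (auto simp: q norm_power power_less_one_iff)
  have bij: "bij (\<lambda>(m, r). (m, r - m :: int))"
    by (rule bij_betw_byWitness[of _ "\<lambda>(m, n). (m, n + m)"]) auto
  have "(\<lambda>p. norm (case p of (m, n) \<Rightarrow> d m * jac u n)) summable_on UNIV"
    using abs_summable_on_times[OF d jac_abs_summable[OF u]] by simp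
  from summable_on_reindex_bij_betw[OF bij, THEN iffD2, OF this]
  have F: "(\<lambda>(m, r). F m r) abs_summable_on UNIV" by (simp add: F_def case_prod_unfold)
  note Q = quadruple_sum[OF F, of "\<lambda>r s. rho r s * q powi (r * s)", OF norm_rho_powi_le_1[OF q0]]
  define f where "f = (\<lambda>(k, l, r, s). rho r s * q powi (r * s) * F k r * F l s)"
  have gF: "(\<Sum>\<^sub>\<infinity>m. F m r) = g r" for r using g by (auto simp: F_def intro: infsumI)
  have inner: "(\<Sum>\<^sub>\<infinity>(r, s). rho r s * q powi (r * s) * F m r * F n s)
      = (if m = n then - (qpoch_inf q q ^ 3) * ((d m)\<^sup>2 * jac u (- m)) else 0)" for m n
  proof -
    have "((\<lambda>p. (d m * d n) * (case p of (r, s) \<Rightarrow> rho r s * q powi (r * s) * jac u (r - m) * jac u (s - n))) has_sum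
      (d m * d n) * (if m = n then - (qpoch_inf q q ^ 3) * jac u (- m) else 0)) UNIV"
      by (intro has_sum_cmult_right kronecker_coefficients u q)
    then have "((\<lambda>(r, s). rho r s * q powi (r * s) * F m r * F n s) has_sum
      (d m * d n) * (if m = n then - (qpoch_inf q q ^ 3) * jac u (- m) else 0)) UNIV"
      by (simp add: F_def case_prod_unfold mult_ac)
    then show ?thesis by (auto simp: power2_eq_square mult_ac dest: infsumI)
  qed
  have "((\<lambda>(m, n). if m = n then - (qpoch_inf q q ^ 3) * ((d m)\<^sup>2 * jac u (- m)) else 0) has_sum infsum f UNIV) UNIV"
    using Q(3) unfolding inner f_def .
  then have "((\<lambda>m. - (qpoch_inf q q ^ 3) * ((d m)\<^sup>2 * jac u (- m))) has_sum infsum f UNIV) UNIV"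
  proof (rule has_sum_SigmaD[where A = UNIV and B = "\<lambda>_. UNIV", unfolded UNIV_Times_UNIV])
    show "((\<lambda>n. case (m, n) of (m, n) \<Rightarrow> if m = n then - (qpoch_inf q q ^ 3) * ((d m)\<^sup>2 * jac u (- m)) else 0)
      has_sum - (qpoch_inf q q ^ 3) * ((d m)\<^sup>2 * jac u (- m))) UNIV" for m
      by (rule has_sum_finite_neutralI[of "{m}"]) auto
  qed
  then have "infsum f UNIV = - (qpoch_inf q q ^ 3) * (\<Sum>\<^sub>\<infinity>m. (d m)\<^sup>2 * jac u (- m))"
    by (simp add: infsumI[symmetric] flip: infsum_cmult_right')
  then show ?thesis using Q(2) unfolding gF f_def by simp
qed

section \<open>Theta series\<close>

lemma bij_int_shift: "bij (\<lambda>n::int. n + c)"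
  by (rule bij_betw_byWitness[of _ "\<lambda>n. n - c"]) auto

lemma bij_int_reflect: "bij (\<lambda>n::int. c - n)"
  by (rule bij_betw_byWitness[of _ "\<lambda>n. c - n"]) auto

lemma norm_power_less_1: "norm (q :: complex) < 1 \<Longrightarrow> 0 < n \<Longrightarrow> norm (q ^ n) < 1"
  by (simp add: norm_power power_less_one_iff)

text \<open>The triple product for nome q^2 at x = q; q itself is the required square root of the
  nome.\<close>

lemma has_sum_theta_alternating:
  assumes q: "q \<noteq> 0" "norm q < 1"
  shows "((\<lambda>n. (-1) powi n * q powi (n\<^sup>2)) has_sum (qpoch_inf q (q\<^sup>2) * qpoch_inf q q)) UNIV"
proof -
  have "((\<lambda>n. jac q n * q powi n) has_sum
      (qpoch_inf q (q\<^sup>2) * qpoch_inf (q\<^sup>2 / q) (q\<^sup>2) * qpoch_inf (q\<^sup>2) (q\<^sup>2))) UNIV"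
    by (rule jacobi_triple_product[OF q refl q(1)])
  moreover have "jac q n * q powi n = (-1) powi n * q powi (n\<^sup>2)" for n
    using power_int_add[OF disjI1[OF q(1)], of "n * (n - 1)" n]
    by (simp add: jac_def power2_eq_square algebra_simps)
  moreover have "q\<^sup>2 / q = q" by (simp add: power2_eq_square)
  moreover have "qpoch_inf q q = qpoch_inf q (q\<^sup>2) * qpoch_inf (q\<^sup>2) (q\<^sup>2)"
    using qpoch_inf_dissect[OF q(2), of 2 q] by (simp add: power2_eq_square numeral_2_eq_2)
  ultimately show ?thesis by (simp add: mult.assoc)
qed

text \<open>The triple product at x = -q; the factor 2 comes from (-1;q) = 2(-q;q), and Euler's
  identity removes (-q;q).\<close>

lemma has_sum_theta_triangular:
  assumes u: "u \<noteq> 0" "norm u < 1" and q: "q = u\<^sup>2"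
  obtains P where "((\<lambda>n. u powi (n\<^sup>2 + n)) has_sum P) UNIV"
    and "qpoch_inf q (q\<^sup>2) * P = 2 * qpoch_inf (q\<^sup>2) (q\<^sup>2)"
proof
  have q0: "q \<noteq> 0" "norm q < 1" using u norm_power_less_1[of u 2] by (auto simp: q)
  have "((\<lambda>n. jac u n * (- q) powi n) has_sum
      (qpoch_inf (- q) q * qpoch_inf (q / - q) q * qpoch_inf q q)) UNIV"
    by (rule jacobi_triple_product[OF u q]) (use q0 in simp)
  moreover have "jac u n * (- q) powi n = u powi (n\<^sup>2 + n)" for n
  proof -
    have "(- q) powi n = (-1) powi n * u powi (2 * n)"
      unfolding power_int_mult[of u 2 n] by (simp add: q minus_one_powi power_int_minus_left)
    then show ?thesis
      using power_int_add[OF disjI1[OF u(1)], of "n * (n - 1)" "2 * n"]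
      by (simp add: jac_def power2_eq_square algebra_simps minus_one_powi)
  qed
  moreover have "q / - q = - 1" using q0 by simp
  ultimately show "((\<lambda>n. u powi (n\<^sup>2 + n)) has_sum
      (qpoch_inf (- q) q * qpoch_inf (- 1) q * qpoch_inf q q)) UNIV" by simp
  have "qpoch_inf (- 1) q = 2 * qpoch_inf (- q) q"
    using qpoch_inf_rec[OF q0(2), of "- 1"] by simp
  moreover have "qpoch_inf (- q) q * qpoch_inf q (q\<^sup>2) = 1" by (rule qpoch_inf_euler[OF q0(2)])
  moreover have "qpoch_inf q q * qpoch_inf (- q) q = qpoch_inf (q\<^sup>2) (q\<^sup>2)"
    by (rule qpoch_inf_square[OF q0(2)])
  ultimately show "qpoch_inf q (q\<^sup>2) * (qpoch_inf (- q) q * qpoch_inf (- 1) q * qpoch_inf q q)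
      = 2 * qpoch_inf (q\<^sup>2) (q\<^sup>2)"
    by algebra
qed

text \<open>In product form P = (-q;q^3)(-q^2;q^3)(q^3;q^3). Splitting (-q;q) modulo 3 and using
  Euler's identity for q and for q^3 shows that the factor (q;q^2) turns P into the alternating
  series in q^3.\<close>

lemma has_sum_theta_pentagonal:
  assumes u: "u \<noteq> 0" "norm u < 1" and q: "q = u\<^sup>2"
  obtains P where "((\<lambda>n. u powi (3 * n\<^sup>2 + n)) has_sum P) UNIV"
    and "((\<lambda>n. (-1) powi n * u powi (6 * n\<^sup>2)) has_sum (qpoch_inf q (q\<^sup>2) * P)) UNIV"
proof
  have q0: "q \<noteq> 0" "norm q < 1" using u norm_power_less_1[of u 2] by (auto simp: q)
  have q3: "q ^ 3 \<noteq> 0" "norm (q ^ 3) < 1" using q0 norm_power_less_1[of q 3] by auto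
  have u3: "u ^ 3 \<noteq> 0" "norm (u ^ 3) < 1" using u norm_power_less_1[of u 3] by auto
  let ?A1 = "qpoch_inf (- q) (q ^ 3)" and ?A2 = "qpoch_inf (- (q\<^sup>2)) (q ^ 3)"
    and ?A3 = "qpoch_inf (- (q ^ 3)) (q ^ 3)"
  have "((\<lambda>n. jac (u ^ 3) n * (- (q\<^sup>2)) powi n) has_sum
      (?A2 * qpoch_inf (q ^ 3 / - (q\<^sup>2)) (q ^ 3) * qpoch_inf (q ^ 3) (q ^ 3))) UNIV"
    by (rule jacobi_triple_product[OF u3]) (use q0 in \<open>simp_all add: q flip: power_mult\<close>)
  moreover have "jac (u ^ 3) n * (- (q\<^sup>2)) powi n = u powi (3 * n\<^sup>2 + n)" for n
  proof -
    have "(- (q\<^sup>2)) powi n = (-1) powi n * u powi (4 * n)"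
      unfolding power_int_mult[of u 4 n] by (simp add: q minus_one_powi power_int_minus_left)
    moreover have "(u ^ 3) powi (n * (n - 1)) = u powi (3 * (n * (n - 1)))"
      unfolding power_int_mult[of u 3] by simp
    ultimately show ?thesis
      using power_int_add[OF disjI1[OF u(1)], of "3 * (n * (n - 1))" "4 * n"]
      by (simp add: jac_def power2_eq_square algebra_simps minus_one_powi)
  qed
  moreover have "q ^ 3 / - (q\<^sup>2) = - q" using q0 by (simp add: power2_eq_square power3_eq_cube)
  ultimately show "((\<lambda>n. u powi (3 * n\<^sup>2 + n)) has_sum (?A2 * ?A1 * qpoch_inf (q ^ 3) (q ^ 3))) UNIV"
    by simp
  have "qpoch_inf (- q) q = ?A1 * ?A2 * ?A3"
    using qpoch_inf_dissect[OF q0(2), of 3 "- q"]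
    by (simp add: power2_eq_square power3_eq_cube numeral_3_eq_3 mult.assoc)
  then have "?A1 * ?A2 * ?A3 * qpoch_inf q (q\<^sup>2) = 1"
    using qpoch_inf_euler[OF q0(2)] by simp
  moreover have "?A3 * qpoch_inf (q ^ 3) ((q ^ 3)\<^sup>2) = 1" by (rule qpoch_inf_euler[OF q3(2)])
  ultimately have b: "qpoch_inf q (q\<^sup>2) * (?A1 * ?A2) = qpoch_inf (q ^ 3) ((q ^ 3)\<^sup>2)"
    by algebra
  have e: "qpoch_inf (q ^ 3) ((q ^ 3)\<^sup>2) * qpoch_inf (q ^ 3) (q ^ 3)
      = qpoch_inf q (q\<^sup>2) * (?A2 * ?A1 * qpoch_inf (q ^ 3) (q ^ 3))"
    unfolding b[symmetric] by (simp only: mult_ac)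
  have "(q ^ 3) powi (n\<^sup>2) = u powi (6 * n\<^sup>2)" for n
    unfolding power_int_mult[of u 6] by (simp add: q flip: power_mult)
  then show "((\<lambda>n. (-1) powi n * u powi (6 * n\<^sup>2)) has_sum
      (qpoch_inf q (q\<^sup>2) * (?A2 * ?A1 * qpoch_inf (q ^ 3) (q ^ 3)))) UNIV"
    using has_sum_theta_alternating[OF q3] unfolding e by simp
qed

text \<open>Splitting (q;q^2) modulo 3 gives (q;q^6)(q^3;q^6)(q^5;q^6). The middle factor acts on P
  by the triangular evaluation for q^3; the outer two complete the product for T.\<close>

lemma has_sum_theta_octagonal:
  assumes u: "u \<noteq> 0" "norm u < 1" and q: "q = u\<^sup>2"
  obtains P T where "((\<lambda>n. u powi (3 * n\<^sup>2 + 3 * n)) has_sum P) UNIV"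
    and "((\<lambda>n. (-1) powi n * u powi (6 * n\<^sup>2 + 4 * n)) has_sum T) UNIV"
    and "qpoch_inf q (q\<^sup>2) * P = 2 * T"
proof -
  have q0: "q \<noteq> 0" "norm q < 1" using u norm_power_less_1[of u 2] by (auto simp: q)
  have u3: "u ^ 3 \<noteq> 0" "norm (u ^ 3) < 1" using u norm_power_less_1[of u 3] by auto
  have u6: "u ^ 6 \<noteq> 0" "norm (u ^ 6) < 1" using u norm_power_less_1[of u 6] by auto
  have q3: "q ^ 3 = (u ^ 3)\<^sup>2" and q6: "q ^ 6 = (u ^ 6)\<^sup>2" by (simp_all add: q flip: power_mult)
  obtain P where P: "((\<lambda>n. (u ^ 3) powi (n\<^sup>2 + n)) has_sum P) UNIV"
    "qpoch_inf (q ^ 3) ((q ^ 3)\<^sup>2) * P = 2 * qpoch_inf ((q ^ 3)\<^sup>2) ((q ^ 3)\<^sup>2)"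
    using has_sum_theta_triangular[OF u3 q3] by blast
  have e3: "(u ^ 3) powi (n\<^sup>2 + n) = u powi (3 * n\<^sup>2 + 3 * n)" for n
    using power_int_mult[of u 3 "n\<^sup>2 + n"] by (simp add: distrib_left)
  let ?T = "qpoch_inf (q ^ 5) (q ^ 6) * qpoch_inf q (q ^ 6) * qpoch_inf (q ^ 6) (q ^ 6)"
  have "((\<lambda>n. jac (u ^ 6) n * (q ^ 5) powi n) has_sum
      (qpoch_inf (q ^ 5) (q ^ 6) * qpoch_inf (q ^ 6 / q ^ 5) (q ^ 6) * qpoch_inf (q ^ 6) (q ^ 6))) UNIV"
    by (rule jacobi_triple_product[OF u6 q6]) (use q0 in simp)
  moreover have "jac (u ^ 6) n * (q ^ 5) powi n = (-1) powi n * u powi (6 * n\<^sup>2 + 4 * n)" for n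
  proof -
    have "(q ^ 5) powi n = u powi (10 * n)"
      unfolding power_int_mult[of u 10 n] by (simp add: q flip: power_mult)
    moreover have "(u ^ 6) powi (n * (n - 1)) = u powi (6 * (n * (n - 1)))"
      unfolding power_int_mult[of u 6] by simp
    ultimately show ?thesis
      using power_int_add[OF disjI1[OF u(1)], of "6 * (n * (n - 1))" "10 * n"]
      by (simp add: jac_def power2_eq_square algebra_simps)
  qed
  moreover have "q ^ 6 / q ^ 5 = q" using q0 by (simp add: eval_nat_numeral)
  ultimately have T: "((\<lambda>n. (-1) powi n * u powi (6 * n\<^sup>2 + 4 * n)) has_sum ?T) UNIV"
    by simp
  have "qpoch_inf q (q\<^sup>2) = qpoch_inf q (q ^ 6) * qpoch_inf (q ^ 3) (q ^ 6) * qpoch_inf (q ^ 5) (q ^ 6)"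
    using qpoch_inf_dissect[OF norm_power_less_1[OF q0(2), of 2], of 3 q]
    by (simp add: numeral_3_eq_3 eval_nat_numeral mult.assoc)
  moreover have "(q ^ 3)\<^sup>2 = q ^ 6" by (simp flip: power_mult)
  ultimately have "qpoch_inf q (q\<^sup>2) * P = 2 * ?T"
    using P(2) by simp
  then show ?thesis using P(1) T unfolding e3 by (rule that[rotated 2])
qed

lemma delta_add: "delta k + delta (k - 1) + delta (k - 2) = 1"
proof -
  have "(if k mod 3 = 0 then 1 else 0) + (if (k - 1) mod 3 = 0 then 1 else 0)
    + (if (k - 2) mod 3 = 0 then 1 else 0) = (1 :: int)"
    by presburger
  then show ?thesis by (auto simp: delta_def split: if_splits)
qed

lemma has_sum_residue_class:
  fixes h :: "int \<Rightarrow> complex"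
  assumes "((\<lambda>n. h (3 * n + c)) has_sum s) UNIV"
  shows "((\<lambda>k. delta (k - c) * h k) has_sum s) UNIV"
proof -
  have "(h has_sum s) (range (\<lambda>n. 3 * n + c))"
    by (subst has_sum_reindex) (use assms in \<open>auto simp: inj_on_def o_def\<close>)
  also have "?this \<longleftrightarrow> ((\<lambda>k. delta (k - c) * h k) has_sum s) UNIV"
  proof (rule has_sum_cong_neutral)
    fix k assume "k \<in> UNIV - range (\<lambda>n. 3 * n + c)"
    moreover have "k = 3 * ((k - c) div 3) + c" if "(k - c) mod 3 = 0"
      using div_mult_mod_eq[of "k - c" 3] that by linarith
    then have "k \<in> range (\<lambda>n. 3 * n + c)" if "(k - c) mod 3 = 0"
      using that by blast
    ultimately have "(k - c) mod 3 \<noteq> 0" by (meson DiffD2)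
    then show "delta (k - c) * h k = 0" by (simp add: delta_def)
  qed (auto simp: delta_def)
  finally show ?thesis .
qed

lemma has_sum_cubic_dissection:
  fixes h :: "int \<Rightarrow> complex"
  assumes "((\<lambda>n. h (3 * n)) has_sum s0) UNIV" "((\<lambda>n. h (3 * n + 1)) has_sum s1) UNIV"
    "((\<lambda>n. h (3 * n + 2)) has_sum s2) UNIV"
  shows "(h has_sum (s0 + s1 + s2)) UNIV"
proof -
  have "((\<lambda>k. delta (k - 0) * h k + delta (k - 1) * h k + delta (k - 2) * h k) has_sum (s0 + s1 + s2)) UNIV"
    by (intro has_sum_add has_sum_residue_class) (use assms in simp_all)
  then show ?thesis by (simp add: delta_add flip: distrib_right)
qed

section \<open>Cubic combinations of theta series\<close>

lemma jac_power: "jac (v ^ k) n = (-1) powi n * v powi (int k * (n * (n - 1)))"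
  by (simp add: jac_def power_int_mult)

lemma residue_mod_3_cases:
  obtains t where "r = 3 * t" | t where "r = 3 * t + 1" | t where "r = 3 * t + (2 :: int)"
proof -
  have "r mod 3 = 0 \<or> r mod 3 = 1 \<or> r mod 3 = 2" by presburger
  moreover have "r = 3 * (r div 3) + r mod 3" by simp
  ultimately show ?thesis using that by (metis add_0_right)
qed

lemma powi_add_eq:
  fixes v :: complex
  shows "v \<noteq> 0 \<Longrightarrow> a + b = c + d \<Longrightarrow> v powi a * v powi b = v powi c * v powi d"
  by (simp flip: power_int_add)

lemma delta_diff_gaussian_abs_summable:
  fixes v :: complex
  assumes v: "v \<noteq> 0" "norm v < 1" and A: "0 < A" "0 < A'"
    and e: "\<And>k r. norm (e k r :: complex) \<le> 1"
  shows "(\<lambda>(k, r). e k r * v powi ((A * k\<^sup>2 + B * k) + (A' * r\<^sup>2 + B' * r))) abs_summable_on UNIV"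
proof -
  have g: "(\<lambda>n::int. v powi (a * n\<^sup>2 + b * n)) abs_summable_on UNIV" if "0 < a" for a b
    using gaussian_abs_summable(1)[of v a b 0] v that by simp
  have "(\<lambda>(k, r). v powi (A * k\<^sup>2 + B * k) * v powi (A' * r\<^sup>2 + B' * r)) abs_summable_on UNIV"
    using abs_summable_on_times[OF g[OF A(1)] g[OF A(2)]] by simp
  then show ?thesis
  proof (rule summable_on_comparison_test)
    fix p :: "int \<times> int"
    obtain k r where p: "p = (k, r)" by fastforce
    have "norm (e k r) * norm (v powi ((A * k\<^sup>2 + B * k) + (A' * r\<^sup>2 + B' * r)))
      \<le> 1 * norm (v powi ((A * k\<^sup>2 + B * k) + (A' * r\<^sup>2 + B' * r)))"
      by (intro mult_right_mono e) simp
    then show "norm (case p of (k, r) \<Rightarrow> e k r * v powi ((A * k\<^sup>2 + B * k) + (A' * r\<^sup>2 + B' * r)))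
      \<le> norm (case p of (k, r) \<Rightarrow> v powi (A * k\<^sup>2 + B * k) * v powi (A' * r\<^sup>2 + B' * r))"
      using v by (simp add: p norm_mult power_int_add)
  qed simp
qed

text \<open>The part of the first summand that depends on k and r alone, without Q^(rs). Exponents
  are powers of a sixth root v of q, hence six times those of q.\<close>

definition cubic_alternating :: "complex \<Rightarrow> int \<Rightarrow> int \<Rightarrow> complex" where
  "cubic_alternating v k r =
    (-1) powi (k + r) * (delta k - delta r) * v powi (2 * k\<^sup>2 + (2 * r\<^sup>2 + 6 * r))"

definition cubic_triangular :: "complex \<Rightarrow> int \<Rightarrow> int \<Rightarrow> complex" where
  "cubic_triangular v k r = (delta (k - 1) - delta r) * v powi ((k\<^sup>2 + k) + (4 * r\<^sup>2 + 6 * r))"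

lemma norm_delta_diff_le_1: "norm (delta k - delta r) \<le> 1"
  by (simp add: delta_def)

lemma cubic_alternating_abs_summable:
  assumes v: "v \<noteq> 0" "norm v < 1"
  shows "(\<lambda>(k, r). cubic_alternating v k r) abs_summable_on UNIV"
  using delta_diff_gaussian_abs_summable[OF v, of 2 2 "\<lambda>k r. (-1) powi (k + r) * (delta k - delta r)" 0 6]
  by (simp add: cubic_alternating_def norm_mult norm_power_int norm_delta_diff_le_1)

lemma cubic_triangular_abs_summable:
  assumes v: "v \<noteq> 0" "norm v < 1"
  shows "(\<lambda>(k, r). cubic_triangular v k r) abs_summable_on UNIV"
  using delta_diff_gaussian_abs_summable[OF v, of 1 4 "\<lambda>k r. delta (k - 1) - delta r" 1 6]
  by (simp add: cubic_triangular_def norm_delta_diff_le_1)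

text \<open>Put \<open>g\<^sub>r = \<Sum>\<^sub>k cubic_alternating v k r\<close>. The function \<open>\<Sum> g\<^sub>r x\<^sup>r\<close> has three zeros modulo
  multiplication of \<open>x\<close> by \<open>q\<^sup>2\<close> and vanishes at all powers of \<open>q\<close>, so it is \<open>\<theta>(x; q)\<close> times a theta
  function of nome \<open>q\<^sup>2\<close>. Comparing coefficients, with \<open>r\<close> in a fixed class modulo \<open>3\<close>, leaves the
  theta identities above.\<close>

lemma cubic_alternating_factorization:
  assumes v: "v \<noteq> 0" "norm v < 1" and q: "q = v ^ 6"
  shows "((\<lambda>m. qpoch_inf q (q\<^sup>2) * (-1) powi m * v powi (6 * m\<^sup>2 + 24 * m + 20) * jac (v ^ 3) (r - m))
    has_sum (\<Sum>\<^sub>\<infinity>k. cubic_alternating v k r)) UNIV"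
proof -
  define b where "b = qpoch_inf q (q\<^sup>2)"
  have u: "v ^ 3 \<noteq> 0" "norm (v ^ 3) < 1" and qu: "q = (v ^ 3)\<^sup>2"
    using v norm_power_less_1[of v 3] by (auto simp: q simp flip: power_mult)
  have uv: "(v ^ 3) powi n = v powi (3 * n)" for n by (simp add: power_int_mult)
  obtain P1 where P1: "((\<lambda>n. v powi (3 * (3 * n\<^sup>2 + n))) has_sum P1) UNIV"
    and T3: "((\<lambda>n. (-1) powi n * v powi (3 * (6 * n\<^sup>2))) has_sum b * P1) UNIV"
    using that by (rule has_sum_theta_pentagonal[OF u qu, unfolded uv, folded b_def])
  obtain P2 T2 where P2: "((\<lambda>n. v powi (3 * (3 * n\<^sup>2 + 3 * n))) has_sum P2) UNIV"
    and T2: "((\<lambda>n. (-1) powi n * v powi (3 * (6 * n\<^sup>2 + 4 * n))) has_sum T2) UNIV"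
    and PT: "b * P2 = 2 * T2"
    using that by (rule has_sum_theta_octagonal[OF u qu, unfolded uv, folded b_def])
  have h1: "((\<lambda>n. - (v powi 2) * ((-1) powi n * v powi (3 * (6 * n\<^sup>2 + 4 * n)))) has_sum - (v powi 2) * T2) UNIV"
    by (rule has_sum_cmult_right[OF T2])
  \<comment> \<open>The classes of 1 and 2 are exchanged by k -> -k and contribute equally; the
    doubled T2 is the one in \<open>PT\<close>.\<close>
  have theta: "((\<lambda>k. (-1) powi k * v powi (2 * k\<^sup>2)) has_sum (b * P1 + - (v powi 2) * T2 + - (v powi 2) * T2)) UNIV"
  proof (rule has_sum_cubic_dissection)
    show "((\<lambda>n. (-1) powi (3 * n) * v powi (2 * (3 * n)\<^sup>2)) has_sum b * P1) UNIV"
      using T3 by (simp add: minus_one_powi power2_eq_square)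
    have "- (v powi 2) * ((-1) powi n * v powi (3 * (6 * n\<^sup>2 + 4 * n))) = (-1) powi (3 * n + 1) * v powi (2 * (3 * n + 1)\<^sup>2)"
      for n
      using power_int_add[OF disjI1[OF v(1)], of 2 "3 * (6 * n\<^sup>2 + 4 * n)"]
      by (simp add: minus_one_powi power2_eq_square algebra_simps)
    then show "((\<lambda>n. (-1) powi (3 * n + 1) * v powi (2 * (3 * n + 1)\<^sup>2)) has_sum - (v powi 2) * T2) UNIV"
      using h1 by simp
    have "- (v powi 2) * ((-1) powi (- 1 - n) * v powi (3 * (6 * (- 1 - n)\<^sup>2 + 4 * (- 1 - n))))
       = (-1) powi (3 * n + 2) * v powi (2 * (3 * n + 2)\<^sup>2)" for n
      using power_int_add[OF disjI1[OF v(1)], of 2 "3 * (6 * (- 1 - n)\<^sup>2 + 4 * (- 1 - n))"]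
      by (simp add: minus_one_powi power2_eq_square algebra_simps)
    then show "((\<lambda>n. (-1) powi (3 * n + 2) * v powi (2 * (3 * n + 2)\<^sup>2)) has_sum - (v powi 2) * T2) UNIV"
      using has_sum_reindex_bij_betw[OF bij_int_reflect[of "- 1"], THEN iffD2, OF h1] by simp
  qed
  have theta0: "((\<lambda>k. delta (k - 0) * ((-1) powi k * v powi (2 * k\<^sup>2))) has_sum b * P1) UNIV"
    by (rule has_sum_residue_class) (use T3 in \<open>simp add: minus_one_powi power2_eq_square\<close>)
  define E where "E = 2 * r\<^sup>2 + 6 * r"
  define g where "g = (-1) powi r * v powi E * (b * P1 + - delta r * (b * P1 + - (v powi 2) * T2 + - (v powi 2) * T2))"
  have "((\<lambda>k. (-1) powi r * v powi E * (delta (k - 0) * ((-1) powi k * v powi (2 * k\<^sup>2))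
      + - delta r * ((-1) powi k * v powi (2 * k\<^sup>2)))) has_sum g) UNIV"
    unfolding g_def by (intro has_sum_cmult_right has_sum_add theta theta0)
  moreover have "(-1) powi r * v powi E * (delta (k - 0) * ((-1) powi k * v powi (2 * k\<^sup>2))
      + - delta r * ((-1) powi k * v powi (2 * k\<^sup>2))) = cubic_alternating v k r" for k
    using v by (simp add: cubic_alternating_def E_def power_int_add algebra_simps)
  ultimately have g: "(\<Sum>\<^sub>\<infinity>k. cubic_alternating v k r) = g" by (simp add: infsumI)
  have "((\<lambda>m. b * (-1) powi m * v powi (6 * m\<^sup>2 + 24 * m + 20) * jac (v ^ 3) (r - m)) has_sum g) UNIV"
  proof (cases rule: residue_mod_3_cases[of r])
    case (1 t)
    \<comment> \<open>For r divisible by 3 the class of 0 cancels and 2 v^2 T2 remains, which is v^2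
      b P2. In the other cases only that class contributes.\<close>
    have ge: "g = (-1) powi r * v powi (E + 2) * b * P2"
      using PT 1 v by (simp add: g_def delta_def power_int_add)
    have *: "((\<lambda>n. (-1) powi r * v powi (E + 2) * b * v powi (3 * (3 * n\<^sup>2 + 3 * n))) has_sum g) UNIV"
      unfolding ge by (rule has_sum_cmult_right[OF P2])
    \<comment> \<open>Completing the square in m gives the shift 1 - t; agreement for every t then
      fixes the terms 24 m + 20 of the coefficient exponent.\<close>
    have eq: "(-1) powi r * v powi (E + 2) * b * v powi (3 * (3 * (m + (1 - t))\<^sup>2 + 3 * (m + (1 - t))))
       = b * (-1) powi m * v powi (6 * m\<^sup>2 + 24 * m + 20) * jac (v ^ 3) (r - m)" for m
    proof -
      have "v powi (E + 2) * v powi (3 * (3 * (m + (1 - t))\<^sup>2 + 3 * (m + (1 - t))))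
         = v powi (6 * m\<^sup>2 + 24 * m + 20) * v powi (3 * ((r - m) * (r - m - 1)))"
        by (rule powi_add_eq[OF v(1)]) (simp add: 1 E_def power2_eq_square algebra_simps)
      moreover have "(-1) powi r = (-1) powi m * (-1 :: complex) powi (r - m)" by (simp add: minus_one_powi)
      ultimately show ?thesis unfolding jac_power of_nat_numeral by algebra
    qed
    show ?thesis
      using has_sum_reindex_bij_betw[OF bij_int_shift[of "1 - t"], THEN iffD2, OF *] unfolding eq .
  next
    case (2 t)
    have ge: "g = (-1) powi r * v powi E * b * P1"
      using 2 by (simp add: g_def delta_def)
    have *: "((\<lambda>n. (-1) powi r * v powi E * b * v powi (3 * (3 * n\<^sup>2 + n))) has_sum g) UNIV"
      unfolding ge by (rule has_sum_cmult_right[OF P1])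
    have eq: "(-1) powi r * v powi E * b * v powi (3 * (3 * (m + (1 - t))\<^sup>2 + (m + (1 - t))))
       = b * (-1) powi m * v powi (6 * m\<^sup>2 + 24 * m + 20) * jac (v ^ 3) (r - m)" for m
    proof -
      have "v powi E * v powi (3 * (3 * (m + (1 - t))\<^sup>2 + (m + (1 - t))))
         = v powi (6 * m\<^sup>2 + 24 * m + 20) * v powi (3 * ((r - m) * (r - m - 1)))"
        by (rule powi_add_eq[OF v(1)]) (simp add: 2 E_def power2_eq_square algebra_simps)
      moreover have "(-1) powi r = (-1) powi m * (-1 :: complex) powi (r - m)" by (simp add: minus_one_powi)
      ultimately show ?thesis unfolding jac_power of_nat_numeral by algebra
    qed
    show ?thesis
      using has_sum_reindex_bij_betw[OF bij_int_shift[of "1 - t"], THEN iffD2, OF *] unfolding eq .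
  next
    case (3 t)
    have "(3 * t + 2) mod 3 = 2" by presburger
    then have ge: "g = (-1) powi r * v powi E * b * P1"
      using 3 by (simp add: g_def delta_def)
    have *: "((\<lambda>n. (-1) powi r * v powi E * b * v powi (3 * (3 * n\<^sup>2 + n))) has_sum g) UNIV"
      unfolding ge by (rule has_sum_cmult_right[OF P1])
    \<comment> \<open>For r = 3t + 2 the linear term in m fits no integral shift, only a
      reflection.\<close>
    have eq: "(-1) powi r * v powi E * b * v powi (3 * (3 * ((t - 1) - m)\<^sup>2 + ((t - 1) - m)))
       = b * (-1) powi m * v powi (6 * m\<^sup>2 + 24 * m + 20) * jac (v ^ 3) (r - m)" for m
    proof -
      have "v powi E * v powi (3 * (3 * ((t - 1) - m)\<^sup>2 + ((t - 1) - m)))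
         = v powi (6 * m\<^sup>2 + 24 * m + 20) * v powi (3 * ((r - m) * (r - m - 1)))"
        by (rule powi_add_eq[OF v(1)]) (simp add: 3 E_def power2_eq_square algebra_simps)
      moreover have "(-1) powi r = (-1) powi m * (-1 :: complex) powi (r - m)" by (simp add: minus_one_powi)
      ultimately show ?thesis unfolding jac_power of_nat_numeral by algebra
    qed
    show ?thesis
      using has_sum_reindex_bij_betw[OF bij_int_reflect[of "t - 1"], THEN iffD2, OF *] unfolding eq .
  qed
  then show ?thesis unfolding g b_def .
qed

text \<open>The roles of the paired theta series are exchanged: the inner sums are the positive
  series P1 and P2, while products with \<open>jac\<close> need the alternating ones. Converting by
  the same identities puts b in the denominator. The nome is now q^2, with square root v^6.\<close>

lemma cubic_triangular_factorization:
  assumes v: "v \<noteq> 0" "norm v < 1" and q: "q = v ^ 6"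
  shows "((\<lambda>m. 2 / qpoch_inf q (q\<^sup>2) * v powi (12 * m\<^sup>2 + 30 * m + 18) * jac (v ^ 6) (r - m))
    has_sum (\<Sum>\<^sub>\<infinity>k. cubic_triangular v k r)) UNIV"
proof -
  define b where "b = qpoch_inf q (q\<^sup>2)"
  have u: "v ^ 3 \<noteq> 0" "norm (v ^ 3) < 1" and qu: "q = (v ^ 3)\<^sup>2"
    using v norm_power_less_1[of v 3] by (auto simp: q simp flip: power_mult)
  have b0: "b \<noteq> 0"
    unfolding b_def using v norm_power_less_1[of v 6] norm_power_less_1[of q 2]
    by (intro qpoch_inf_nonzero) (auto simp: q)
  have uv: "(v ^ 3) powi n = v powi (3 * n)" for n by (simp add: power_int_mult)
  obtain P1 where P1: "((\<lambda>n. v powi (3 * (3 * n\<^sup>2 + n))) has_sum P1) UNIV"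
    and T3: "((\<lambda>n. (-1) powi n * v powi (3 * (6 * n\<^sup>2))) has_sum b * P1) UNIV"
    using that by (rule has_sum_theta_pentagonal[OF u qu, unfolded uv, folded b_def])
  obtain P2 T2 where P2: "((\<lambda>n. v powi (3 * (3 * n\<^sup>2 + 3 * n))) has_sum P2) UNIV"
    and T2: "((\<lambda>n. (-1) powi n * v powi (3 * (6 * n\<^sup>2 + 4 * n))) has_sum T2) UNIV"
    and PT: "b * P2 = 2 * T2"
    using that by (rule has_sum_theta_octagonal[OF u qu, unfolded uv, folded b_def])
  have h1: "((\<lambda>n. v powi ((3 * n + 1)\<^sup>2 + (3 * n + 1))) has_sum v powi 2 * P2) UNIV"
  proof -
    have "v powi 2 * v powi (3 * (3 * n\<^sup>2 + 3 * n)) = v powi ((3 * n + 1)\<^sup>2 + (3 * n + 1))" for n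
      using power_int_add[OF disjI1[OF v(1)], of 2 "3 * (3 * n\<^sup>2 + 3 * n)"]
      by (simp add: power2_eq_square algebra_simps)
    then show ?thesis using has_sum_cmult_right[OF P2, of "v powi 2"] by simp
  qed
  \<comment> \<open>Here k -> -1 - k exchanges the classes of 0 and 2, which give P1 each, and maps
    the class of 1 to itself.\<close>
  have theta: "((\<lambda>k. v powi (k\<^sup>2 + k)) has_sum (P1 + v powi 2 * P2 + P1)) UNIV"
  proof (rule has_sum_cubic_dissection)
    show "((\<lambda>n. v powi ((3 * n)\<^sup>2 + 3 * n)) has_sum P1) UNIV"
      using P1 by (simp add: power2_eq_square algebra_simps)
    show "((\<lambda>n. v powi ((3 * n + 1)\<^sup>2 + (3 * n + 1))) has_sum v powi 2 * P2) UNIV" by (rule h1)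
    have e: "3 * (3 * (- 1 - n)\<^sup>2 + (- 1 - n)) = (3 * n + 2)\<^sup>2 + (3 * n + 2)" for n :: int
      by (simp add: power2_eq_square algebra_simps)
    show "((\<lambda>n. v powi ((3 * n + 2)\<^sup>2 + (3 * n + 2))) has_sum P1) UNIV"
      using has_sum_reindex_bij_betw[OF bij_int_reflect[of "- 1"], THEN iffD2, OF P1] unfolding e .
  qed
  have theta1: "((\<lambda>k. delta (k - 1) * v powi (k\<^sup>2 + k)) has_sum v powi 2 * P2) UNIV"
    by (rule has_sum_residue_class[OF h1])
  define E where "E = 4 * r\<^sup>2 + 6 * r"
  define g where "g = v powi E * (v powi 2 * P2 + - delta r * (P1 + v powi 2 * P2 + P1))"
  have "((\<lambda>k. v powi E * (delta (k - 1) * v powi (k\<^sup>2 + k) + - delta r * v powi (k\<^sup>2 + k))) has_sum g) UNIV"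
    unfolding g_def by (intro has_sum_cmult_right has_sum_add theta theta1)
  moreover have "v powi E * (delta (k - 1) * v powi (k\<^sup>2 + k) + - delta r * v powi (k\<^sup>2 + k))
      = cubic_triangular v k r" for k
    unfolding cubic_triangular_def E_def[symmetric] power_int_add[OF disjI1[OF v(1)], of "k\<^sup>2 + k" E]
    by (simp add: algebra_simps)
  ultimately have g: "(\<Sum>\<^sub>\<infinity>k. cubic_triangular v k r) = g" by (simp add: infsumI)
  have "((\<lambda>m. 2 / b * v powi (12 * m\<^sup>2 + 30 * m + 18) * jac (v ^ 6) (r - m)) has_sum g) UNIV"
  proof (cases rule: residue_mod_3_cases[of r])
    case (1 t)
    have ge: "g = - (v powi E) * (2 / b) * (b * P1)"
      using 1 b0 by (simp add: g_def delta_def)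
    have *: "((\<lambda>n. - (v powi E) * (2 / b) * ((-1) powi n * v powi (3 * (6 * n\<^sup>2)))) has_sum g) UNIV"
      unfolding ge by (rule has_sum_cmult_right[OF T3])
    have eq: "- (v powi E) * (2 / b) * ((-1) powi (m + (1 - t)) * v powi (3 * (6 * (m + (1 - t))\<^sup>2)))
       = 2 / b * v powi (12 * m\<^sup>2 + 30 * m + 18) * jac (v ^ 6) (r - m)" for m
    proof -
      have "v powi E * v powi (3 * (6 * (m + (1 - t))\<^sup>2))
         = v powi (12 * m\<^sup>2 + 30 * m + 18) * v powi (6 * ((r - m) * (r - m - 1)))"
        by (rule powi_add_eq[OF v(1)]) (simp add: 1 E_def power2_eq_square algebra_simps)
      moreover have "(-1) powi (m + (1 - t)) = - ((-1 :: complex) powi (r - m))"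
        by (simp add: 1 minus_one_powi)
      ultimately show ?thesis unfolding jac_power of_nat_numeral by algebra
    qed
    show ?thesis
      using has_sum_reindex_bij_betw[OF bij_int_shift[of "1 - t"], THEN iffD2, OF *] unfolding eq .
  next
    case (2 t)
    have ge: "g = v powi (E + 2) * (2 / b) * T2"
      using 2 b0 PT v by (simp add: g_def delta_def power_int_add field_simps)
    have *: "((\<lambda>n. v powi (E + 2) * (2 / b) * ((-1) powi n * v powi (3 * (6 * n\<^sup>2 + 4 * n)))) has_sum g) UNIV"
      unfolding ge by (rule has_sum_cmult_right[OF T2])
    have eq: "v powi (E + 2) * (2 / b) * ((-1) powi ((t - 1) - m) * v powi (3 * (6 * ((t - 1) - m)\<^sup>2 + 4 * ((t - 1) - m))))
       = 2 / b * v powi (12 * m\<^sup>2 + 30 * m + 18) * jac (v ^ 6) (r - m)" for m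
    proof -
      have "v powi (E + 2) * v powi (3 * (6 * ((t - 1) - m)\<^sup>2 + 4 * ((t - 1) - m)))
         = v powi (12 * m\<^sup>2 + 30 * m + 18) * v powi (6 * ((r - m) * (r - m - 1)))"
        by (rule powi_add_eq[OF v(1)]) (simp add: 2 E_def power2_eq_square algebra_simps)
      moreover have "(-1) powi ((t - 1) - m) = (-1 :: complex) powi (r - m)"
        by (simp add: 2 minus_one_powi)
      ultimately show ?thesis unfolding jac_power of_nat_numeral by algebra
    qed
    show ?thesis
      using has_sum_reindex_bij_betw[OF bij_int_reflect[of "t - 1"], THEN iffD2, OF *] unfolding eq .
  next
    case (3 t)
    have "(3 * t + 2) mod 3 = 2" by presburger
    then have ge: "g = v powi (E + 2) * (2 / b) * T2"
      using 3 b0 PT v by (simp add: g_def delta_def power_int_add field_simps)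
    have *: "((\<lambda>n. v powi (E + 2) * (2 / b) * ((-1) powi n * v powi (3 * (6 * n\<^sup>2 + 4 * n)))) has_sum g) UNIV"
      unfolding ge by (rule has_sum_cmult_right[OF T2])
    have eq: "v powi (E + 2) * (2 / b) * ((-1) powi (m + - t) * v powi (3 * (6 * (m + - t)\<^sup>2 + 4 * (m + - t))))
       = 2 / b * v powi (12 * m\<^sup>2 + 30 * m + 18) * jac (v ^ 6) (r - m)" for m
    proof -
      have "v powi (E + 2) * v powi (3 * (6 * (m + - t)\<^sup>2 + 4 * (m + - t)))
         = v powi (12 * m\<^sup>2 + 30 * m + 18) * v powi (6 * ((r - m) * (r - m - 1)))"
        by (rule powi_add_eq[OF v(1)]) (simp add: 3 E_def power2_eq_square algebra_simps)
      moreover have "(-1) powi (m + - t) = (-1 :: complex) powi (r - m)"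
        by (simp add: 3 minus_one_powi)
      ultimately show ?thesis unfolding jac_power of_nat_numeral by algebra
    qed
    show ?thesis
      using has_sum_reindex_bij_betw[OF bij_int_shift[of "- t"], THEN iffD2, OF *] unfolding eq .
  qed
  then show ?thesis unfolding g b_def .
qed

section \<open>Evaluation of the quadruple sums\<close>

text \<open>The constant \<open>c\<close> takes the power of q left over after distribution to the
  kernels: v^2 = q^(1/3) in the first identity, 1 in the other three.\<close>

lemma quadruple_hecke_sum:
  fixes F :: "int \<Rightarrow> int \<Rightarrow> complex"
  assumes u: "u \<noteq> 0" "norm u < 1" and q: "q = u\<^sup>2"
    and F: "(\<lambda>(k, r). F k r) abs_summable_on UNIV"
    and d: "d abs_summable_on UNIV"
    and g: "\<And>r. ((\<lambda>m. d m * jac u (r - m)) has_sum (\<Sum>\<^sub>\<infinity>k. F k r)) UNIV"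
    and S: "((\<lambda>m. (d m)\<^sup>2 * jac u (- m)) has_sum S) UNIV"
  shows "(\<lambda>(k, l, r, s). c * (rho r s * q powi (r * s) * F k r * F l s)) abs_summable_on UNIV"
    and "(\<Sum>\<^sub>\<infinity>(k, l, r, s). c * (rho r s * q powi (r * s) * F k r * F l s)) = c * (- (qpoch_inf q q ^ 3) * S)"
proof -
  have q0: "q \<noteq> 0" "norm q < 1" using u norm_power_less_1[of u 2] by (auto simp: q)
  note Q = quadruple_sum[OF F, of "\<lambda>r s. rho r s * q powi (r * s)", OF norm_rho_powi_le_1[OF q0]]
  let ?f = "\<lambda>(k, l, r, s). rho r s * q powi (r * s) * F k r * F l s"
  have cf: "(\<lambda>(k, l, r, s). c * (rho r s * q powi (r * s) * F k r * F l s)) = (\<lambda>p. c * ?f p)"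
    by (simp add: fun_eq_iff)
  show "(\<lambda>(k, l, r, s). c * (rho r s * q powi (r * s) * F k r * F l s)) abs_summable_on UNIV"
    unfolding cf norm_mult[of c] using Q(1) by (rule summable_on_cmult_right)
  have "infsum ?f UNIV = - (qpoch_inf q q ^ 3) * S"
    using has_sum_unique[OF Q(2) hecke_sum_convolution[OF u q d g]] infsumI[OF S] by simp
  then show "(\<Sum>\<^sub>\<infinity>(k, l, r, s). c * (rho r s * q powi (r * s) * F k r * F l s)) = c * (- (qpoch_inf q q ^ 3) * S)"
    unfolding cf infsum_cmult_right' by simp
qed

text \<open>Evenness of E expresses that 3a is an integer, so the floor in \<open>qpow\<close> is
  exact.\<close>

lemma qpow_eq:
  assumes w: "w = v\<^sup>2" and "6 * a = of_int E" "even E"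
  shows "qpow w a = v powi E"
proof -
  obtain e where e: "E = 2 * e" using assms by (auto elim: evenE)
  then have "3 * a = of_int e" using assms by simp
  then show ?thesis by (simp add: qpow_def w e power_int_mult)
qed

section \<open>Squares of the cofactor coefficients\<close>

lemma alternating_gaussian_abs_summable:
  fixes v :: complex
  assumes v: "v \<noteq> 0" "norm v < 1" and A: "0 < A"
  shows "(\<lambda>n::int. (-1) powi n * v powi (A * n\<^sup>2 + B * n + C)) abs_summable_on UNIV"
  using gaussian_abs_summable(1)[of v A B C] v A by (simp add: norm_mult norm_power_int)

text \<open>The exponents add up to 15m^2 + 51m + 40, which is 15n^2 + 9n - 2 for m = -2 - n. The
  leftover v^(-2) cancels the constant v^2 of the first identity. This even recentring keeps the
  sign, while the recentrings for the other three identities are odd; hence the minus sign in the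
  first identity alone.\<close>

lemma cubic_alternating_coefficients:
  fixes b :: complex
  assumes v: "v \<noteq> 0" "norm v < 1"
  defines "d \<equiv> \<lambda>m. b * (-1) powi m * v powi (6 * m\<^sup>2 + 24 * m + 20)"
  shows "d abs_summable_on UNIV"
    and "((\<lambda>m. (d m)\<^sup>2 * jac (v ^ 3) (- m)) has_sum
      (b\<^sup>2 / v\<^sup>2 * (\<Sum>\<^sub>\<infinity>n. (-1) powi n * v powi (15 * n\<^sup>2 + 9 * n)))) UNIV"
proof -
  show "d abs_summable_on UNIV"
    using summable_on_cmult_right[OF alternating_gaussian_abs_summable[OF v, of 6 24 20], of "norm b"]
    by (simp add: d_def norm_mult mult.assoc)
  let ?U = "\<lambda>n::int. (-1) powi n * v powi (15 * n\<^sup>2 + 9 * n)"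
  have "?U summable_on UNIV"
    using abs_summable_summable[OF alternating_gaussian_abs_summable[OF v, of 15 9 0]] by simp
  then have "((\<lambda>n. b\<^sup>2 / v\<^sup>2 * ?U n) has_sum (b\<^sup>2 / v\<^sup>2 * infsum ?U UNIV)) UNIV"
    by (intro has_sum_cmult_right has_sum_infsum)
  note * = has_sum_reindex_bij_betw[OF bij_int_reflect[of "- 2"], THEN iffD2, OF this]
  have eq: "b\<^sup>2 / v\<^sup>2 * ?U (- 2 - m) = (d m)\<^sup>2 * jac (v ^ 3) (- m)" for m
  proof -
    have "v powi (15 * (- 2 - m)\<^sup>2 + 9 * (- 2 - m)) =
        v powi 2 * ((v powi (6 * m\<^sup>2 + 24 * m + 20))\<^sup>2 * v powi (3 * (- m * (- m - 1))))"
      unfolding power2_eq_square[of "v powi _"] power_int_add[OF disjI1[OF v(1)], symmetric]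
      by (rule arg_cong[of _ _ "power_int v"]) (simp add: power2_eq_square algebra_simps)
    then show ?thesis
      using v by (simp add: d_def jac_power minus_one_powi power_mult_distrib field_simps)
  qed
  show "((\<lambda>m. (d m)\<^sup>2 * jac (v ^ 3) (- m)) has_sum (b\<^sup>2 / v\<^sup>2 * infsum ?U UNIV)) UNIV"
    using * unfolding eq .
qed

lemma cubic_triangular_coefficients:
  fixes b :: complex
  assumes v: "v \<noteq> 0" "norm v < 1"
  defines "d \<equiv> \<lambda>m. 2 / b * v powi (12 * m\<^sup>2 + 30 * m + 18)"
  shows "d abs_summable_on UNIV"
    and "((\<lambda>m. (d m)\<^sup>2 * jac (v ^ 6) (- m)) has_sum
      (- (4 / b\<^sup>2) * (\<Sum>\<^sub>\<infinity>n. (-1) powi n * v powi (30 * n\<^sup>2 + 6 * n)))) UNIV"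
proof -
  show "d abs_summable_on UNIV"
    using summable_on_cmult_right[OF gaussian_abs_summable(1)[of v 12 30 18], of "norm (2 / b)"] v
    by (simp add: d_def norm_mult norm_divide)
  let ?U = "\<lambda>n::int. (-1) powi n * v powi (30 * n\<^sup>2 + 6 * n)"
  have "?U summable_on UNIV"
    using abs_summable_summable[OF alternating_gaussian_abs_summable[OF v, of 30 6 0]] by simp
  then have "((\<lambda>n. - (4 / b\<^sup>2) * ?U n) has_sum (- (4 / b\<^sup>2) * infsum ?U UNIV)) UNIV"
    by (intro has_sum_cmult_right has_sum_infsum)
  note * = has_sum_reindex_bij_betw[OF bij_int_shift[of 1], THEN iffD2, OF this]
  \<comment> \<open>The exponent 30m^2 + 66m + 36 loses its constant term when recentred at m =
    -1.\<close>
  have eq: "- (4 / b\<^sup>2) * ?U (m + 1) = (d m)\<^sup>2 * jac (v ^ 6) (- m)" for m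
  proof -
    have "v powi (30 * (m + 1)\<^sup>2 + 6 * (m + 1)) =
        (v powi (12 * m\<^sup>2 + 30 * m + 18))\<^sup>2 * v powi (6 * (- m * (- m - 1)))"
      using v unfolding power2_eq_square[of "v powi _"]
      by (simp flip: power_int_add) (simp add: power2_eq_square algebra_simps)
    then show ?thesis
      by (simp add: d_def jac_power minus_one_powi power_mult_distrib power_divide)
  qed
  show "((\<lambda>m. (d m)\<^sup>2 * jac (v ^ 6) (- m)) has_sum (- (4 / b\<^sup>2) * infsum ?U UNIV)) UNIV"
    using * unfolding eq .
qed

lemma cubic_alternating_shift_coefficients:
  fixes b :: complex
  assumes v: "v \<noteq> 0" "norm v < 1"
  defines "d \<equiv> \<lambda>m. b * (-1) powi m * v powi (6 * m\<^sup>2 + 12 * m + 6)"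
  shows "d abs_summable_on UNIV"
    and "((\<lambda>m. (d m)\<^sup>2 * jac (v ^ 3) (- m)) has_sum
      (- (b\<^sup>2) * (\<Sum>\<^sub>\<infinity>n. (-1) powi n * v powi (15 * n\<^sup>2 + 3 * n)))) UNIV"
proof -
  show "d abs_summable_on UNIV"
    using summable_on_cmult_right[OF alternating_gaussian_abs_summable[OF v, of 6 12 6], of "norm b"]
    by (simp add: d_def norm_mult mult.assoc)
  let ?U = "\<lambda>n::int. (-1) powi n * v powi (15 * n\<^sup>2 + 3 * n)"
  have "?U summable_on UNIV"
    using abs_summable_summable[OF alternating_gaussian_abs_summable[OF v, of 15 3 0]] by simp
  then have "((\<lambda>n. - (b\<^sup>2) * ?U n) has_sum (- (b\<^sup>2) * infsum ?U UNIV)) UNIV"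
    by (intro has_sum_cmult_right has_sum_infsum)
  note * = has_sum_reindex_bij_betw[OF bij_int_reflect[of "- 1"], THEN iffD2, OF this]
  have eq: "- (b\<^sup>2) * ?U (- 1 - m) = (d m)\<^sup>2 * jac (v ^ 3) (- m)" for m
  proof -
    have "v powi (15 * (- 1 - m)\<^sup>2 + 3 * (- 1 - m)) =
        (v powi (6 * m\<^sup>2 + 12 * m + 6))\<^sup>2 * v powi (3 * (- m * (- m - 1)))"
      using v unfolding power2_eq_square[of "v powi _"]
      by (simp flip: power_int_add) (simp add: power2_eq_square algebra_simps)
    then show ?thesis
      by (simp add: d_def jac_power minus_one_powi power_mult_distrib)
  qed
  show "((\<lambda>m. (d m)\<^sup>2 * jac (v ^ 3) (- m)) has_sum (- (b\<^sup>2) * infsum ?U UNIV)) UNIV"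
    using * unfolding eq .
qed

lemma cubic_triangular_reflect_coefficients:
  fixes b :: complex
  assumes v: "v \<noteq> 0" "norm v < 1"
  defines "d \<equiv> \<lambda>m. - (2 / b) * v powi (12 * m\<^sup>2 + 18 * m + 6)"
  shows "d abs_summable_on UNIV"
    and "((\<lambda>m. (d m)\<^sup>2 * jac (v ^ 6) (- m)) has_sum
      (- (4 / b\<^sup>2) * (\<Sum>\<^sub>\<infinity>n. (-1) powi n * v powi (30 * n\<^sup>2 + 18 * n)))) UNIV"
proof -
  show "d abs_summable_on UNIV"
    using summable_on_cmult_right[OF gaussian_abs_summable(1)[of v 12 18 6], of "norm (2 / b)"] v
    by (simp add: d_def norm_mult norm_divide)
  let ?U = "\<lambda>n::int. (-1) powi n * v powi (30 * n\<^sup>2 + 18 * n)"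
  have "?U summable_on UNIV"
    using abs_summable_summable[OF alternating_gaussian_abs_summable[OF v, of 30 18 0]] by simp
  then have "((\<lambda>n. - (4 / b\<^sup>2) * ?U n) has_sum (- (4 / b\<^sup>2) * infsum ?U UNIV)) UNIV"
    by (intro has_sum_cmult_right has_sum_infsum)
  note * = has_sum_reindex_bij_betw[OF bij_int_reflect[of "- 1"], THEN iffD2, OF this]
  have eq: "- (4 / b\<^sup>2) * ?U (- 1 - m) = (d m)\<^sup>2 * jac (v ^ 6) (- m)" for m
  proof -
    have "v powi (30 * (- 1 - m)\<^sup>2 + 18 * (- 1 - m)) =
        (v powi (12 * m\<^sup>2 + 18 * m + 6))\<^sup>2 * v powi (6 * (- m * (- m - 1)))"
      using v unfolding power2_eq_square[of "v powi _"]
      by (simp flip: power_int_add) (simp add: power2_eq_square algebra_simps)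
    then show ?thesis
      by (simp add: d_def jac_power minus_one_powi power_mult_distrib power_divide)
  qed
  show "((\<lambda>m. (d m)\<^sup>2 * jac (v ^ 6) (- m)) has_sum (- (4 / b\<^sup>2) * infsum ?U UNIV)) UNIV"
    using * unfolding eq .
qed

section \<open>Shifted and reflected kernels for the second and fourth identities\<close>

lemma bij_map_snd: "bij \<tau> \<Longrightarrow> bij (\<lambda>(k, r). (k, \<tau> r))"
  by (rule bij_betw_byWitness[of _ "\<lambda>(k, r). (k, inv \<tau> r)"])
    (auto simp: bij_is_inj bij_is_surj surj_f_inv_f)

text \<open>Replacing r by r - 1 turns 2r^2 + 6r into 2r^2 + 2r - 4 and flips the sign; the factor
  -(v^4) restores the kernel of the second identity.\<close>

lemma cubic_alternating_shift_abs_summable: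
  assumes v: "v \<noteq> 0" "norm v < 1"
  shows "(\<lambda>(k, r). - (v ^ 4) * cubic_alternating v k (r + - 1)) abs_summable_on UNIV"
proof -
  have "(\<lambda>p. norm (case (case p of (k, r) \<Rightarrow> (k, r + - 1)) of (k, r) \<Rightarrow> cubic_alternating v k r)) summable_on UNIV"
    using summable_on_reindex_bij_betw[OF bij_map_snd[OF bij_int_shift[of "- 1"]], THEN iffD2,
        OF cubic_alternating_abs_summable[OF v]] .
  from summable_on_cmult_right[OF this, of "norm (v ^ 4)"] show ?thesis
    by (simp add: case_prod_unfold norm_mult)
qed

text \<open>Reflection turns 4r^2 + 6r into 4r^2 + 2r - 2. The two terms -2, from r and from s,
  account for the -2 in the fourth identity, so no correction factor appears.\<close>

lemma cubic_triangular_reflect_abs_summable: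
  assumes v: "v \<noteq> 0" "norm v < 1"
  shows "(\<lambda>(k, r). cubic_triangular v k (- 1 - r)) abs_summable_on UNIV"
  using summable_on_reindex_bij_betw[OF bij_map_snd[OF bij_int_reflect[of "- 1"]], THEN iffD2,
      OF cubic_triangular_abs_summable[OF v]]
  by (simp add: case_prod_unfold)

text \<open>Shifting r and m together preserves r - m, so only the coefficients change.\<close>

lemma cubic_alternating_shift_factorization:
  assumes v: "v \<noteq> 0" "norm v < 1" and q: "q = v ^ 6"
  shows "((\<lambda>m. qpoch_inf q (q\<^sup>2) * (-1) powi m * v powi (6 * m\<^sup>2 + 12 * m + 6) * jac (v ^ 3) (r - m))
    has_sum (\<Sum>\<^sub>\<infinity>k. - (v ^ 4) * cubic_alternating v k (r + - 1))) UNIV"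
proof -
  define b where "b = qpoch_inf q (q\<^sup>2)"
  note * = has_sum_cmult_right[OF has_sum_reindex_bij_betw[OF bij_int_shift[of "- 1"], THEN iffD2,
        OF cubic_alternating_factorization[OF v q, folded b_def, of "r + - 1"]], of "- (v ^ 4)"]
  have "- (v ^ 4) * (b * (-1) powi (m + - 1) * v powi (6 * (m + - 1)\<^sup>2 + 24 * (m + - 1) + 20)
      * jac (v ^ 3) (r + - 1 - (m + - 1)))
    = b * (-1) powi m * v powi (6 * m\<^sup>2 + 12 * m + 6) * jac (v ^ 3) (r - m)" for m
  proof -
    have "v powi 4 * v powi (6 * (m + - 1)\<^sup>2 + 24 * (m + - 1) + 20) = v powi (6 * m\<^sup>2 + 12 * m + 6)"
      unfolding power_int_add[OF disjI1[OF v(1)], symmetric]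
      by (rule arg_cong[of _ _ "power_int v"]) (simp add: power2_eq_square algebra_simps)
    then have e1: "v ^ 4 * v powi (6 * (m + - 1)\<^sup>2 + 24 * (m + - 1) + 20) = v powi (6 * m\<^sup>2 + 12 * m + 6)"
      by simp
    have e2: "(-1) powi (m + - 1) = - ((-1 :: complex) powi m)" by (simp add: minus_one_powi)
    have e3: "r + - 1 - (m + - 1) = r - m" by simp
    show ?thesis unfolding e2 e3 e1[symmetric]
      by (simp only: mult_ac mult_minus_left mult_minus_right minus_minus)
  qed
  with * show ?thesis by (simp only: infsum_cmult_right' b_def)
qed

text \<open>The substitution m -> -2 - m turns the argument of \<open>jac\<close> into 1 - (r - m),
  and \<open>jac\<close> changes sign under n -> 1 - n.\<close>

lemma cubic_triangular_reflect_factorization: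
  assumes v: "v \<noteq> 0" "norm v < 1" and q: "q = v ^ 6"
  shows "((\<lambda>m. - (2 / qpoch_inf q (q\<^sup>2)) * v powi (12 * m\<^sup>2 + 18 * m + 6) * jac (v ^ 6) (r - m))
    has_sum (\<Sum>\<^sub>\<infinity>k. cubic_triangular v k (- 1 - r))) UNIV"
proof -
  define b where "b = qpoch_inf q (q\<^sup>2)"
  note * = has_sum_reindex_bij_betw[OF bij_int_reflect[of "- 2"], THEN iffD2,
        OF cubic_triangular_factorization[OF v q, folded b_def, of "- 1 - r"]]
  have "2 / b * v powi (12 * (- 2 - m)\<^sup>2 + 30 * (- 2 - m) + 18) * jac (v ^ 6) (- 1 - r - (- 2 - m))
    = - (2 / b) * v powi (12 * m\<^sup>2 + 18 * m + 6) * jac (v ^ 6) (r - m)" for m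
  proof -
    have e1: "12 * (- 2 - m)\<^sup>2 + 30 * (- 2 - m) + 18 = 12 * m\<^sup>2 + 18 * m + 6"
      by (simp add: power2_eq_square algebra_simps)
    have e2: "(- 1 - r - (- 2 - m)) * (- 1 - r - (- 2 - m) - 1) = (r - m) * (r - m - 1)"
      by (simp add: algebra_simps)
    have e3: "(-1) powi (- 1 - r - (- 2 - m)) = - ((-1 :: complex) powi (r - m))"
      by (simp add: minus_one_powi)
    show ?thesis unfolding jac_power e1 e2 e3 by simp
  qed
  with * show ?thesis by (simp only: b_def)
qed

section \<open>Summands of the statement in terms of the kernels\<close>

lemma summand_alternating:
  assumes v: "v \<noteq> 0" and w: "w = v\<^sup>2" and q: "q = v ^ 6"
  shows "rho r s * (-1) powi (k + l + r + s) * (delta k - delta r) * (delta l - delta s)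
      * qpow w (of_int (k\<^sup>2 + l\<^sup>2 + r\<^sup>2 + 3 * r * s + s\<^sup>2 + 3 * r + 3 * s + 1) / 3)
    = v\<^sup>2 * (rho r s * q powi (r * s) * cubic_alternating v k r * cubic_alternating v l s)"
proof -
  have "qpow w (of_int (k\<^sup>2 + l\<^sup>2 + r\<^sup>2 + 3 * r * s + s\<^sup>2 + 3 * r + 3 * s + 1) / 3)
    = v powi (2 * (k\<^sup>2 + l\<^sup>2 + r\<^sup>2 + 3 * r * s + s\<^sup>2 + 3 * r + 3 * s + 1))"
    by (rule qpow_eq[OF w]) simp_all
  also have "\<dots> = v powi 2 * (v powi (6 * (r * s)) * v powi (2 * k\<^sup>2 + (2 * r\<^sup>2 + 6 * r))
      * v powi (2 * l\<^sup>2 + (2 * s\<^sup>2 + 6 * s)))"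
    unfolding power_int_add[OF disjI1[OF v], symmetric]
    by (rule arg_cong[of _ _ "power_int v"]) (simp add: algebra_simps)
  also have "v powi (6 * (r * s)) = q powi (r * s)" by (simp add: q power_int_mult)
  finally have e: "qpow w (of_int (k\<^sup>2 + l\<^sup>2 + r\<^sup>2 + 3 * r * s + s\<^sup>2 + 3 * r + 3 * s + 1) / 3)
    = v powi 2 * (q powi (r * s) * v powi (2 * k\<^sup>2 + (2 * r\<^sup>2 + 6 * r)) * v powi (2 * l\<^sup>2 + (2 * s\<^sup>2 + 6 * s)))" .
  have "(-1) powi (k + l + r + s) = (-1) powi (k + r) * (-1 :: complex) powi (l + s)"
    by (simp add: minus_one_powi) presburger
  then show ?thesis unfolding e cubic_alternating_def by simp
qed

lemma summand_alternating_shift: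
  assumes v: "v \<noteq> 0" and w: "w = v\<^sup>2" and q: "q = v ^ 6"
  shows "rho r s * (-1) powi (k + l + r + s) * (delta k - delta (r - 1)) * (delta l - delta (s - 1))
      * qpow w (of_int (k\<^sup>2 + l\<^sup>2 + r\<^sup>2 + 3 * r * s + s\<^sup>2 + r + s) / 3)
    = 1 * (rho r s * q powi (r * s) * (- (v ^ 4) * cubic_alternating v k (r + - 1))
      * (- (v ^ 4) * cubic_alternating v l (s + - 1)))"
proof -
  have "qpow w (of_int (k\<^sup>2 + l\<^sup>2 + r\<^sup>2 + 3 * r * s + s\<^sup>2 + r + s) / 3)
    = v powi (2 * (k\<^sup>2 + l\<^sup>2 + r\<^sup>2 + 3 * r * s + s\<^sup>2 + r + s))"
    by (rule qpow_eq[OF w]) simp_all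
  also have "\<dots> = v powi (6 * (r * s)) * (v powi 4 * v powi (2 * k\<^sup>2 + (2 * (r + - 1)\<^sup>2 + 6 * (r + - 1)))
      * (v powi 4 * v powi (2 * l\<^sup>2 + (2 * (s + - 1)\<^sup>2 + 6 * (s + - 1)))))"
    unfolding power_int_add[OF disjI1[OF v], symmetric]
    by (rule arg_cong[of _ _ "power_int v"]) (simp add: power2_eq_square algebra_simps)
  also have "v powi (6 * (r * s)) = q powi (r * s)" by (simp add: q power_int_mult)
  finally have e: "qpow w (of_int (k\<^sup>2 + l\<^sup>2 + r\<^sup>2 + 3 * r * s + s\<^sup>2 + r + s) / 3)
    = q powi (r * s) * (v powi 4 * v powi (2 * k\<^sup>2 + (2 * (r + - 1)\<^sup>2 + 6 * (r + - 1)))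
      * (v powi 4 * v powi (2 * l\<^sup>2 + (2 * (s + - 1)\<^sup>2 + 6 * (s + - 1)))))" .
  have "(-1) powi (k + l + r + s) = (-1) powi (k + (r + - 1)) * (-1 :: complex) powi (l + (s + - 1))"
    by (simp add: minus_one_powi) presburger
  then show ?thesis unfolding e cubic_alternating_def by simp
qed

lemma summand_triangular:
  assumes v: "v \<noteq> 0" and w: "w = v\<^sup>2" and q: "q = v ^ 6"
  shows "rho r s * (delta (k - 1) - delta r) * (delta (l - 1) - delta s)
      * qpow w ((of_int (k * (k + 1)) / 2 + of_int (l * (l + 1)) / 2
          + of_int (2 * r\<^sup>2 + 6 * r * s + 2 * s\<^sup>2 + 3 * r + 3 * s)) / 3)
    = 1 * (rho r s * (q\<^sup>2) powi (r * s) * cubic_triangular v k r * cubic_triangular v l s)"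
proof -
  have "qpow w ((of_int (k * (k + 1)) / 2 + of_int (l * (l + 1)) / 2
          + of_int (2 * r\<^sup>2 + 6 * r * s + 2 * s\<^sup>2 + 3 * r + 3 * s)) / 3)
    = v powi (k * (k + 1) + l * (l + 1) + 2 * (2 * r\<^sup>2 + 6 * r * s + 2 * s\<^sup>2 + 3 * r + 3 * s))"
    \<comment> \<open>The exponent is even because k(k+1) and l(l+1) are products of consecutive
      integers.\<close>
    by (rule qpow_eq[OF w]; simp add: field_simps; blast)
  also have "\<dots> = v powi (12 * (r * s)) * v powi ((k\<^sup>2 + k) + (4 * r\<^sup>2 + 6 * r))
      * v powi ((l\<^sup>2 + l) + (4 * s\<^sup>2 + 6 * s))"
    unfolding power_int_add[OF disjI1[OF v], symmetric]
    by (rule arg_cong[of _ _ "power_int v"]) (simp add: power2_eq_square algebra_simps)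
  also have "v powi (12 * (r * s)) = (q\<^sup>2) powi (r * s)" by (simp add: q power_int_mult flip: power_mult)
  finally show ?thesis unfolding cubic_triangular_def by simp
qed

lemma summand_triangular_reflect:
  assumes v: "v \<noteq> 0" and w: "w = v\<^sup>2" and q: "q = v ^ 6"
  shows "rho r s * (delta (k - 1) - delta (r + 1)) * (delta (l - 1) - delta (s + 1))
      * qpow w ((of_int (k * (k + 1)) / 2 + of_int (l * (l + 1)) / 2
          + of_int (2 * r\<^sup>2 + 6 * r * s + 2 * s\<^sup>2 + r + s - 2)) / 3)
    = 1 * (rho r s * (q\<^sup>2) powi (r * s) * cubic_triangular v k (- 1 - r) * cubic_triangular v l (- 1 - s))"
proof -
  have "qpow w ((of_int (k * (k + 1)) / 2 + of_int (l * (l + 1)) / 2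
          + of_int (2 * r\<^sup>2 + 6 * r * s + 2 * s\<^sup>2 + r + s - 2)) / 3)
    = v powi (k * (k + 1) + l * (l + 1) + 2 * (2 * r\<^sup>2 + 6 * r * s + 2 * s\<^sup>2 + r + s - 2))"
    by (rule qpow_eq[OF w]; simp add: field_simps; blast)
  also have "\<dots> = v powi (12 * (r * s)) * v powi ((k\<^sup>2 + k) + (4 * (- 1 - r)\<^sup>2 + 6 * (- 1 - r)))
      * v powi ((l\<^sup>2 + l) + (4 * (- 1 - s)\<^sup>2 + 6 * (- 1 - s)))"
    unfolding power_int_add[OF disjI1[OF v], symmetric]
    by (rule arg_cong[of _ _ "power_int v"]) (simp add: power2_eq_square algebra_simps)
  also have "v powi (12 * (r * s)) = (q\<^sup>2) powi (r * s)" by (simp add: q power_int_mult flip: power_mult)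
  finally have e: "qpow w ((of_int (k * (k + 1)) / 2 + of_int (l * (l + 1)) / 2
          + of_int (2 * r\<^sup>2 + 6 * r * s + 2 * s\<^sup>2 + r + s - 2)) / 3)
    = (q\<^sup>2) powi (r * s) * v powi ((k\<^sup>2 + k) + (4 * (- 1 - r)\<^sup>2 + 6 * (- 1 - r)))
      * v powi ((l\<^sup>2 + l) + (4 * (- 1 - s)\<^sup>2 + 6 * (- 1 - s)))" .
  have "delta (- 1 - r) = delta (r + 1)" for r
  proof -
    have "(- 1 - r) mod 3 = 0 \<longleftrightarrow> (r + 1) mod 3 = 0" by presburger
    then show ?thesis by (simp add: delta_def)
  qed
  then show ?thesis unfolding e cubic_triangular_def by simp
qed

theorem theorem1p1:
  fixes q w :: complex
  assumes "0 < norm q" and "norm q < 1" and "w ^ 3 = q"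
  shows
   "(let f = (\<lambda>(k, l, r, s). rho r s * (-1) powi (k + l + r + s) * (delta k - delta r) * (delta l - delta s)
             * qpow w (of_int (k\<^sup>2 + l\<^sup>2 + r\<^sup>2 + 3 * r * s + s\<^sup>2 + 3 * r + 3 * s + 1) / 3));
         t = (\<lambda>n::int. (-1) powi n * qpow w (of_int (n\<^sup>2)));
         u = (\<lambda>n::int. (-1) powi n * qpow w (5 * of_int (n\<^sup>2) / 2 + 3 * of_int n / 2))
     in (\<lambda>x. norm (f x)) summable_on UNIV \<and> (\<lambda>x. norm (t x)) summable_on UNIV \<and>
        (\<lambda>x. norm (u x)) summable_on UNIV \<and>
        (\<Sum>\<^sub>\<infinity>x. f x) = - qpoch_inf q q * (\<Sum>\<^sub>\<infinity>n. t n)\<^sup>2 * (\<Sum>\<^sub>\<infinity>n. u n)) \<and>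
    (let f = (\<lambda>(k, l, r, s). rho r s * (-1) powi (k + l + r + s) * (delta k - delta (r - 1)) * (delta l - delta (s - 1))
             * qpow w (of_int (k\<^sup>2 + l\<^sup>2 + r\<^sup>2 + 3 * r * s + s\<^sup>2 + r + s) / 3));
         t = (\<lambda>n::int. (-1) powi n * qpow w (of_int (n\<^sup>2)));
         u = (\<lambda>n::int. (-1) powi n * qpow w (5 * of_int (n\<^sup>2) / 2 + of_int n / 2))
     in (\<lambda>x. norm (f x)) summable_on UNIV \<and> (\<lambda>x. norm (t x)) summable_on UNIV \<and>
        (\<lambda>x. norm (u x)) summable_on UNIV \<and>
        (\<Sum>\<^sub>\<infinity>x. f x) = qpoch_inf q q * (\<Sum>\<^sub>\<infinity>n. t n)\<^sup>2 * (\<Sum>\<^sub>\<infinity>n. u n)) \<and>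
    (let f = (\<lambda>(k, l, r, s). rho r s * (delta (k - 1) - delta r) * (delta (l - 1) - delta s)
             * qpow w ((of_int (k * (k + 1)) / 2 + of_int (l * (l + 1)) / 2 + of_int (2 * r\<^sup>2 + 6 * r * s + 2 * s\<^sup>2 + 3 * r + 3 * s)) / 3));
         t = (\<lambda>n::int. qpow w (of_int (n * (n + 1)) / 2));
         u = (\<lambda>n::int. (-1) powi n * qpow w (of_int (5 * n\<^sup>2 + n)))
     in (\<lambda>x. norm (f x)) summable_on UNIV \<and> (\<lambda>x. norm (t x)) summable_on UNIV \<and>
        (\<lambda>x. norm (u x)) summable_on UNIV \<and>
        (\<Sum>\<^sub>\<infinity>x. f x) = qpoch_inf (q\<^sup>2) (q\<^sup>2) * (\<Sum>\<^sub>\<infinity>n. t n)\<^sup>2 * (\<Sum>\<^sub>\<infinity>n. u n)) \<and>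
    (let f = (\<lambda>(k, l, r, s). rho r s * (delta (k - 1) - delta (r + 1)) * (delta (l - 1) - delta (s + 1))
             * qpow w ((of_int (k * (k + 1)) / 2 + of_int (l * (l + 1)) / 2 + of_int (2 * r\<^sup>2 + 6 * r * s + 2 * s\<^sup>2 + r + s - 2)) / 3));
         t = (\<lambda>n::int. qpow w (of_int (n * (n + 1)) / 2));
         u = (\<lambda>n::int. (-1) powi n * qpow w (of_int (5 * n\<^sup>2 + 3 * n)))
     in (\<lambda>x. norm (f x)) summable_on UNIV \<and> (\<lambda>x. norm (t x)) summable_on UNIV \<and>
        (\<lambda>x. norm (u x)) summable_on UNIV \<and>
        (\<Sum>\<^sub>\<infinity>x. f x) = qpoch_inf (q\<^sup>2) (q\<^sup>2) * (\<Sum>\<^sub>\<infinity>n. t n)\<^sup>2 * (\<Sum>\<^sub>\<infinity>n. u n))"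
proof -
  \<comment> \<open>A square root of w makes q = v^6, so v^3 and v^6 are square roots of the nomes q
    and q^2.\<close>
  define v where "v = csqrt w"
  have w: "w = v\<^sup>2" by (simp add: v_def)
  have q: "q = v ^ 6" using assms(3) by (simp add: w flip: power_mult)
  have v: "v \<noteq> 0" "norm v < 1"
  proof -
    show "v \<noteq> 0" using assms(1) by (auto simp: q)
    have "norm v ^ 6 < 1" using assms(2) by (simp add: q norm_power)
    then show "norm v < 1" by (simp add: power_less_one_iff)
  qed
  have q0: "q \<noteq> 0" "norm q < 1" using assms by auto
  have u3: "v ^ 3 \<noteq> 0" "norm (v ^ 3) < 1" "q = (v ^ 3)\<^sup>2"
    using v norm_power_less_1[of v 3] by (auto simp: q simp flip: power_mult)
  have u6: "v ^ 6 \<noteq> 0" "norm (v ^ 6) < 1" "q\<^sup>2 = (v ^ 6)\<^sup>2" using q0 by (auto simp: q)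
  define b where "b = qpoch_inf q (q\<^sup>2)"
  have b0: "b \<noteq> 0"
    unfolding b_def using q0 norm_power_less_1[of q 2] by (intro qpoch_inf_nonzero) auto

  have t_alt: "qpow w (of_int (n\<^sup>2)) = v powi (6 * n\<^sup>2)" for n
    by (rule qpow_eq[OF w]) simp_all
  have t_tri: "qpow w (of_int (n * (n + 1)) / 2) = v powi (3 * n\<^sup>2 + 3 * n)" for n
    by (rule qpow_eq[OF w]) (simp_all add: power2_eq_square algebra_simps)
  have u_1: "qpow w (5 * of_int (n\<^sup>2) / 2 + 3 * of_int n / 2) = v powi (15 * n\<^sup>2 + 9 * n)" for n
    by (rule qpow_eq[OF w]) simp_all
  have u_2: "qpow w (5 * of_int (n\<^sup>2) / 2 + of_int n / 2) = v powi (15 * n\<^sup>2 + 3 * n)" for n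
    by (rule qpow_eq[OF w]) simp_all
  have u_3: "qpow w (of_int (5 * n\<^sup>2 + n)) = v powi (30 * n\<^sup>2 + 6 * n)" for n
    by (rule qpow_eq[OF w]) simp_all
  have u_4: "qpow w (of_int (5 * n\<^sup>2 + 3 * n)) = v powi (30 * n\<^sup>2 + 18 * n)" for n
    by (rule qpow_eq[OF w]) simp_all

  \<comment> \<open>The squares of these two evaluations absorb the factors b^2 and 4/b^2 of the
    coefficient sums together with two of the three factors (Q;Q).\<close>
  have t_alt_sum: "(\<Sum>\<^sub>\<infinity>n. (-1) powi n * v powi (6 * n\<^sup>2)) = b * qpoch_inf q q"
  proof -
    have "q powi (n\<^sup>2) = v powi (6 * n\<^sup>2)" for n by (simp add: q power_int_mult)
    then show ?thesis
      using infsumI[OF has_sum_theta_alternating[OF q0]] by (simp add: b_def)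
  qed
  have t_tri_sum: "(\<Sum>\<^sub>\<infinity>n. v powi (3 * n\<^sup>2 + 3 * n)) = 2 * qpoch_inf (q\<^sup>2) (q\<^sup>2) / b"
  proof -
    obtain P where P: "((\<lambda>n. (v ^ 3) powi (n\<^sup>2 + n)) has_sum P) UNIV"
      "b * P = 2 * qpoch_inf (q\<^sup>2) (q\<^sup>2)"
      using has_sum_theta_triangular[OF u3] unfolding b_def by blast
    have "(v ^ 3) powi (n\<^sup>2 + n) = v powi (3 * n\<^sup>2 + 3 * n)" for n
      using power_int_mult[of v 3 "n\<^sup>2 + n"] by (simp add: distrib_left)
    then show ?thesis using infsumI[OF P(1)] P(2) b0 by (simp add: field_simps)
  qed

  note sums1 = quadruple_hecke_sum[OF u3 cubic_alternating_abs_summable[OF v]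
      cubic_alternating_coefficients(1)[OF v] cubic_alternating_factorization[OF v q]
      cubic_alternating_coefficients(2)[OF v], of "v\<^sup>2", folded b_def]
  note sums2 = quadruple_hecke_sum[OF u3 cubic_alternating_shift_abs_summable[OF v]
      cubic_alternating_shift_coefficients(1)[OF v] cubic_alternating_shift_factorization[OF v q]
      cubic_alternating_shift_coefficients(2)[OF v], of 1, folded b_def]
  note sums3 = quadruple_hecke_sum[OF u6 cubic_triangular_abs_summable[OF v]
      cubic_triangular_coefficients(1)[OF v] cubic_triangular_factorization[OF v q]
      cubic_triangular_coefficients(2)[OF v], of 1, folded b_def]
  note sums4 = quadruple_hecke_sum[OF u6 cubic_triangular_reflect_abs_summable[OF v]
      cubic_triangular_reflect_coefficients(1)[OF v] cubic_triangular_reflect_factorization[OF v q]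
      cubic_triangular_reflect_coefficients(2)[OF v], of 1, folded b_def]
  note gaussian = alternating_gaussian_abs_summable[OF v, of _ _ 0, unfolded add_0_right]

  have triangular: "(\<lambda>n::int. norm (v powi (3 * n\<^sup>2 + 3 * n))) summable_on UNIV"
    using gaussian_abs_summable(1)[of v 3 3 0] v by simp
  have square: "(\<lambda>n::int. norm ((-1) powi n * v powi (6 * n\<^sup>2))) summable_on UNIV"
    using gaussian[of 6 0] by simp
  show ?thesis
    unfolding Let_def summand_alternating[OF v(1) w q] summand_alternating_shift[OF v(1) w q]
      summand_triangular[OF v(1) w q] summand_triangular_reflect[OF v(1) w q]
      t_alt t_tri u_1 u_2 u_3 u_4 t_alt_sum t_tri_sum sums1(2) sums2(2) sums3(2) sums4(2)
    by (intro conjI sums1(1) sums2(1) sums3(1) sums4(1) triangular square gaussian)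
      (use v(1) b0 in \<open>simp_all add: power_mult_distrib power_divide power2_eq_square power3_eq_cube\<close>)
qed

end
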